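(* Let $n\ge 2$ and let $\Omega\subset\mathbb{R}^n$ be a bounded domain with smooth boundary, symmetric with respect to the origin. The eigenvalues of problem P in $\Omega$ form two series and, accordingly, the system of eigenfunctions of problem P consists of two series. The first series consists of the eigenfunctions $v$ of the Dirichlet problem $$-\Delta v(x)=\lambda v(x),\ x\in\Omega;\qquad v(x)=0,\ x\in\partial\Omega,$$ having the symmetry property $v(x)-v(x^* )=0$ for $x\in\Omega$. The second series consists of the eigenfunctions $w$ of the Neumann problem $$-\Delta w(x)=\lambda w(x),\ x\in\Omega;\qquad \frac{\partial w}{\partial n_x}(x)=0,\ x\in\partial\Omega,$$ having the symmetry property $w(x)+w(x^* )=0$ for $x\in\Omega$. That is, for each $\lambda$ the eigenspace of problem P for $\lambda$ is spanned by the Dirichlet eigenfunctions for $\lambda$ with the first symmetry property together with the Neumann eigenfunctions for $\lambda$ with the second symmetry property.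
   Context: For $x=(x_1,\dots,x_n)$ put $x^*=-x$. Symmetry of $\Omega$ with respect to the origin means that $x\in\Omega$ implies $x^*\in\Omega$. Put $\partial\Omega_+=\partial\Omega\cap\{x_1\ge 0\}$, and let $\partial/\partial n_x$ denote the derivative in the direction of the outer normal to $\partial\Omega$, taken at the boundary point at which the function is evaluated. Problem P in $\Omega$: given $f$, find $u$ with $-\Delta u(x)=f(x)$ for $x\in\Omega$, subject to the boundary conditions $u(x)=-u(x^* )$ and $\frac{\partial u(x)}{\partial n_x}=\frac{\partial u(x^* )}{\partial n_x}$ for $x\in\partial\Omega_+$. The associated operator $\mathcal{L}_\Omega$ is the closure in $L_2(\Omega)$ of $u\mapsto-\Delta u$ defined on the functions $u\in C^{2+\alpha}(\overline\Omega)$, $0<\alpha<1$, satisfying these two boundary conditions. Eigenvalues and eigenfunctions of problem P are those of $\mathcal{L}_\Omega$, i.e. the numbers $\lambda$ and nonzero functions $u$ with $-\Delta u=\lambda u$ in $\Omega$ and $u$ satisfying the two boundary conditions. *)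

theory Defs
  imports "HOL-Analysis.Analysis" "HOL-Library.Function_Algebras"
begin

section \<open>Partial derivatives and smoothness on open sets\<close>

definition partial_deriv :: "'n::finite \<Rightarrow> (real^'n \<Rightarrow> 'b::real_normed_vector) \<Rightarrow> real^'n \<Rightarrow> 'b" where
  "partial_deriv i f x = frechet_derivative f (at x) (axis i 1)"

definition laplacian :: "(real^'n::finite \<Rightarrow> 'b::real_normed_vector) \<Rightarrow> real^'n \<Rightarrow> 'b" where
  "laplacian f x = (\<Sum>i\<in>UNIV. partial_deriv i (partial_deriv i f) x)"

definition gradient :: "(real^'n::finite \<Rightarrow> real) \<Rightarrow> real^'n \<Rightarrow> real^'n" where
  "gradient f x = (\<chi> i. partial_deriv i f x)"

text \<open>The class $C^k(S)$; the set S is always open below.\<close>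

primrec Ck_on :: "nat \<Rightarrow> (real^'n::finite) set \<Rightarrow> (real^'n \<Rightarrow> 'b::real_normed_vector) \<Rightarrow> bool" where
  "Ck_on 0 S f \<longleftrightarrow> continuous_on S f"
| "Ck_on (Suc k) S f \<longleftrightarrow>
     (\<forall>x\<in>S. f differentiable (at x)) \<and> (\<forall>i. Ck_on k S (partial_deriv i f))"

definition smooth_on :: "(real^'n::finite) set \<Rightarrow> (real^'n \<Rightarrow> 'b::real_normed_vector) \<Rightarrow> bool" where
  "smooth_on S f \<longleftrightarrow> (\<forall>k. Ck_on k S f)"


section \<open>Smooth boundary and outer normal\<close>

text \<open>Near p the set Omega is a strict sublevel set of g, so its boundary in U is the
  regular hypersurface g = 0 and Omega lies on one side of it.\<close>

definition local_defining_function ::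
  "(real^'n::finite) set \<Rightarrow> real^'n \<Rightarrow> (real^'n) set \<Rightarrow> (real^'n \<Rightarrow> real) \<Rightarrow> bool" where
  "local_defining_function \<Omega> p U g \<longleftrightarrow>
     open U \<and> p \<in> U \<and> smooth_on U g \<and> (\<forall>x\<in>U. gradient g x \<noteq> 0) \<and>
     \<Omega> \<inter> U = {x\<in>U. g x < 0}"

definition smooth_boundary :: "(real^'n::finite) set \<Rightarrow> bool" where
  "smooth_boundary \<Omega> \<longleftrightarrow> (\<forall>p\<in>frontier \<Omega>. \<exists>U g. local_defining_function \<Omega> p U g)"

text \<open>The unit vector in the direction of the gradient at p does not depend on the choice
  of the local defining function. Here \<^const>\<open>sgn\<close> is normalisation of vectors.\<close>

definition outer_normal :: "(real^'n::finite) set \<Rightarrow> real^'n \<Rightarrow> real^'n" where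
  "outer_normal \<Omega> p = (THE \<nu>. \<exists>U g. local_defining_function \<Omega> p U g \<and> \<nu> = sgn (gradient g p))"

text \<open>The functions are given on the closure of Omega only, so the derivative at a boundary
  point in the direction of the outer normal is taken from inside, i.e. from t \<open>\<le>\<close> 0.\<close>

definition normal_deriv ::
  "(real^'n::finite) set \<Rightarrow> (real^'n \<Rightarrow> complex) \<Rightarrow> real^'n \<Rightarrow> complex" where
  "normal_deriv \<Omega> u p =
     vector_derivative (\<lambda>t. u (p + t *\<^sub>R outer_normal \<Omega> p)) (at 0 within {..0})"


section \<open>The space $C^{2+\alpha}$ of the closure of Omega\<close>

definition extends_continuously :: "(real^'n::finite) set \<Rightarrow> (real^'n \<Rightarrow> complex) \<Rightarrow> bool" where
  "extends_continuously \<Omega> f \<longleftrightarrow>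
     (\<exists>h. continuous_on (closure \<Omega>) h \<and> (\<forall>x\<in>\<Omega>. h x = f x))"

definition holder_on :: "real \<Rightarrow> (real^'n::finite) set \<Rightarrow> (real^'n \<Rightarrow> complex) \<Rightarrow> bool" where
  "holder_on \<alpha> S f \<longleftrightarrow>
     (\<exists>C. \<forall>x\<in>S. \<forall>y\<in>S. norm (f x - f y) \<le> C * dist x y powr \<alpha>)"

text \<open>A function on the closure of Omega is represented by its extension by 0 to the whole
  space; this makes the representation unique, so that equality of functions and linear spans
  have their usual meaning.\<close>

definition C2_holder :: "real \<Rightarrow> (real^'n::finite) set \<Rightarrow> (real^'n \<Rightarrow> complex) set" where
  "C2_holder \<alpha> \<Omega> = {u.
     (\<forall>x. x \<notin> closure \<Omega> \<longrightarrow> u x = 0) \<and>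
     continuous_on (closure \<Omega>) u \<and>
     Ck_on 2 \<Omega> u \<and>
     (\<forall>i. extends_continuously \<Omega> (partial_deriv i u)) \<and>
     (\<forall>i j. extends_continuously \<Omega> (partial_deriv j (partial_deriv i u))) \<and>
     (\<forall>i j. holder_on \<alpha> \<Omega> (partial_deriv j (partial_deriv i u)))}"


section \<open>The three boundary value problems\<close>

text \<open>The index k names the coordinate that plays the role of $x_1$.\<close>

definition problem_P_domain ::
  "'n::finite \<Rightarrow> real \<Rightarrow> (real^'n) set \<Rightarrow> (real^'n \<Rightarrow> complex) set" where
  "problem_P_domain k \<alpha> \<Omega> = {u \<in> C2_holder \<alpha> \<Omega>.
     \<forall>x \<in> frontier \<Omega> \<inter> {x. x $ k \<ge> 0}.
       u x = - u (- x) \<and> normal_deriv \<Omega> u x = normal_deriv \<Omega> u (- x)}"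

definition dirichlet_domain :: "real \<Rightarrow> (real^'n::finite) set \<Rightarrow> (real^'n \<Rightarrow> complex) set" where
  "dirichlet_domain \<alpha> \<Omega> = {v \<in> C2_holder \<alpha> \<Omega>. \<forall>x\<in>frontier \<Omega>. v x = 0}"

definition neumann_domain :: "real \<Rightarrow> (real^'n::finite) set \<Rightarrow> (real^'n \<Rightarrow> complex) set" where
  "neumann_domain \<alpha> \<Omega> = {w \<in> C2_holder \<alpha> \<Omega>. \<forall>x\<in>frontier \<Omega>. normal_deriv \<Omega> w x = 0}"


section \<open>Classical eigenfunctions\<close>

definition eigenspace ::
  "(real^'n::finite) set \<Rightarrow> (real^'n \<Rightarrow> complex) set \<Rightarrow> complex \<Rightarrow> (real^'n \<Rightarrow> complex) set" where
  "eigenspace \<Omega> D lam = {u \<in> D. \<forall>x\<in>\<Omega>. - laplacian u x = lam * u x}"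

definition eigenfunctions ::
  "(real^'n::finite) set \<Rightarrow> (real^'n \<Rightarrow> complex) set \<Rightarrow> complex \<Rightarrow> (real^'n \<Rightarrow> complex) set" where
  "eigenfunctions \<Omega> D lam = {u \<in> eigenspace \<Omega> D lam. \<exists>x\<in>\<Omega>. u x \<noteq> 0}"

definition cspan :: "('a \<Rightarrow> complex) set \<Rightarrow> ('a \<Rightarrow> complex) set" where
  "cspan S = module.span (\<lambda>c f x. c * f x) S"


section \<open>Eigenfunctions of the closure in $L_2$\<close>

text \<open>Elements of $L_2(\Omega)$ are represented by functions, to be read up to equality almost
  everywhere in Omega; an operator is represented by its graph.\<close>

definition L2_on :: "(real^'n::finite) set \<Rightarrow> (real^'n \<Rightarrow> complex) set" where
  "L2_on \<Omega> = {u \<in> borel_measurable (lebesgue_on \<Omega>).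
     integrable (lebesgue_on \<Omega>) (\<lambda>x. (norm (u x))\<^sup>2)}"

definition L2_tendsto ::
  "(real^'n::finite) set \<Rightarrow> (nat \<Rightarrow> real^'n \<Rightarrow> complex) \<Rightarrow> (real^'n \<Rightarrow> complex) \<Rightarrow> bool" where
  "L2_tendsto \<Omega> U u \<longleftrightarrow>
     (\<lambda>m. \<integral>\<^sup>+x. ennreal ((norm (U m x - u x))\<^sup>2) \<partial>lebesgue_on \<Omega>) \<longlonglongrightarrow> 0"

definition neg_laplace_graph ::
  "(real^'n \<Rightarrow> complex) set \<Rightarrow> ((real^'n::finite \<Rightarrow> complex) \<times> (real^'n \<Rightarrow> complex)) set" where
  "neg_laplace_graph D = {(u, \<lambda>x. - laplacian u x) | u. u \<in> D}"

definition L2_closure ::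
  "(real^'n::finite) set \<Rightarrow> ((real^'n \<Rightarrow> complex) \<times> (real^'n \<Rightarrow> complex)) set
     \<Rightarrow> ((real^'n \<Rightarrow> complex) \<times> (real^'n \<Rightarrow> complex)) set" where
  "L2_closure \<Omega> A = {(u, f). u \<in> L2_on \<Omega> \<and> f \<in> L2_on \<Omega> \<and>
     (\<exists>U F. (\<forall>m. (U m, F m) \<in> A) \<and> L2_tendsto \<Omega> U u \<and> L2_tendsto \<Omega> F f)}"

definition L2_eigenspace ::
  "(real^'n::finite) set \<Rightarrow> (real^'n \<Rightarrow> complex) set \<Rightarrow> complex \<Rightarrow> (real^'n \<Rightarrow> complex) set" where
  "L2_eigenspace \<Omega> D lam =
     {u. (u, \<lambda>x. lam * u x) \<in> L2_closure \<Omega> (neg_laplace_graph D)}"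

definition L2_eigenfunctions ::
  "(real^'n::finite) set \<Rightarrow> (real^'n \<Rightarrow> complex) set \<Rightarrow> complex \<Rightarrow> (real^'n \<Rightarrow> complex) set" where
  "L2_eigenfunctions \<Omega> D lam =
     {u \<in> L2_eigenspace \<Omega> D lam. \<not> (AE x in lebesgue_on \<Omega>. u x = 0)}"

text \<open>The linear span in $L_2(\Omega)$, i.e. modulo equality almost everywhere.\<close>

definition L2_span ::
  "(real^'n::finite) set \<Rightarrow> (real^'n \<Rightarrow> complex) set \<Rightarrow> (real^'n \<Rightarrow> complex) set" where
  "L2_span \<Omega> S = {u \<in> L2_on \<Omega>. \<exists>s\<in>cspan S. AE x in lebesgue_on \<Omega>. u x = s x}"


section \<open>The two series\<close>

definition first_series ::
  "real \<Rightarrow> (real^'n::finite) set \<Rightarrow> complex \<Rightarrow> (real^'n \<Rightarrow> complex) set" where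
  "first_series \<alpha> \<Omega> lam =
     {v \<in> eigenfunctions \<Omega> (dirichlet_domain \<alpha> \<Omega>) lam. \<forall>x\<in>\<Omega>. v x - v (- x) = 0}"

definition second_series ::
  "real \<Rightarrow> (real^'n::finite) set \<Rightarrow> complex \<Rightarrow> (real^'n \<Rightarrow> complex) set" where
  "second_series \<alpha> \<Omega> lam =
     {w \<in> eigenfunctions \<Omega> (neumann_domain \<alpha> \<Omega>) lam. \<forall>x\<in>\<Omega>. w x + w (- x) = 0}"

definition L2_first_series ::
  "real \<Rightarrow> (real^'n::finite) set \<Rightarrow> complex \<Rightarrow> (real^'n \<Rightarrow> complex) set" where
  "L2_first_series \<alpha> \<Omega> lam =
     {v \<in> L2_eigenfunctions \<Omega> (dirichlet_domain \<alpha> \<Omega>) lam.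
        AE x in lebesgue_on \<Omega>. v x - v (- x) = 0}"

definition L2_second_series ::
  "real \<Rightarrow> (real^'n::finite) set \<Rightarrow> complex \<Rightarrow> (real^'n \<Rightarrow> complex) set" where
  "L2_second_series \<alpha> \<Omega> lam =
     {w \<in> L2_eigenfunctions \<Omega> (neumann_domain \<alpha> \<Omega>) lam.
        AE x in lebesgue_on \<Omega>. w x + w (- x) = 0}"

end

theory Submission
  imports Defs
begin

text \<open>Every function is the sum of its even and its odd part with respect to \<open>x \<mapsto> - x\<close>, and the
  Laplacian commutes with taking these parts. The boundary conditions of problem P decouple along
  this decomposition: \<open>u x = - u (- x)\<close> says that the even part vanishes on the boundary, and, since
  the outer normals at \<open>x\<close> and \<open>- x\<close> are opposite (\<open>outer_normal_reflect\<close>), the equality of the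
  normal derivatives says that the odd part has vanishing normal derivative. Thus the even part of
  an element of the domain of problem P lies in the Dirichlet domain and the odd part in the Neumann
  domain, and conversely the even part of a Dirichlet function and the odd part of a Neumann
  function satisfy the conditions of problem P (\<open>even_part_dirichlet\<close>, \<open>odd_part_neumann\<close>,
  \<open>even_part_of_dirichlet\<close>, \<open>odd_part_of_neumann\<close>). For classical eigenfunctions this is the claim.

  The analytic point is that normal derivatives exist (\<open>has_normal_deriv\<close>) and hence are linear and
  compatible with reflection. This requires that the outer normal be well defined
  (\<open>outer_normal_eq\<close>) and that the segment in the direction opposite to it run inside the domain.

  For the closures in \<open>L2\<close> the same decomposition is applied to the approximating sequences. Taking
  even or odd parts is continuous in \<open>L2\<close>, as Lebesgue measure is invariant under reflection, so
  it maps the graph closure of one operator into that of the other (\<open>L2_closure_parity_part\<close>).\<close>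

section \<open>Calculus of iterated partial derivatives\<close>

lemma partial_deriv_eqI:
  "(f has_derivative f') (at x) \<Longrightarrow> partial_deriv i f x = f' (axis i 1)"
  unfolding partial_deriv_def by (metis frechet_derivative_at)

text \<open>The Frechet derivative is recovered from the partial derivatives; differentiability is
  assumed because \<^const>\<open>partial_deriv\<close> has an unspecified value elsewhere.\<close>

lemma has_derivative_partial_deriv:
  assumes "f differentiable (at x)"
  shows "(f has_derivative (\<lambda>d. \<Sum>i\<in>UNIV. d $ i *\<^sub>R partial_deriv i f x)) (at x)"
proof -
  have D: "(f has_derivative frechet_derivative f (at x)) (at x)"
    using assms by (simp add: frechet_derivative_works)
  then have lin: "linear (frechet_derivative f (at x))"
    by (rule has_derivative_linear)
  have "frechet_derivative f (at x) d = (\<Sum>i\<in>UNIV. d $ i *\<^sub>R partial_deriv i f x)" for d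
  proof -
    have "frechet_derivative f (at x) d
        = frechet_derivative f (at x) (\<Sum>i\<in>UNIV. d $ i *\<^sub>R axis i 1)"
      by (simp add: basis_expansion flip: scalar_mult_eq_scaleR)
    also have "\<dots> = (\<Sum>i\<in>UNIV. d $ i *\<^sub>R partial_deriv i f x)"
      by (simp add: linear_sum[OF lin] linear_scale[OF lin] partial_deriv_def)
    finally show ?thesis .
  qed
  then have "frechet_derivative f (at x) = (\<lambda>d. \<Sum>i\<in>UNIV. d $ i *\<^sub>R partial_deriv i f x)"
    by blast
  with D show ?thesis by simp
qed

lemma differentiable_cong_open:
  assumes "open S" "x \<in> S" "\<And>y. y \<in> S \<Longrightarrow> f y = g y" "f differentiable (at x)"
  shows "g differentiable (at x)"
  using assms has_derivative_transform_within_open unfolding differentiable_def by blast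

text \<open>No differentiability is needed: on an open set the two functions have the same Frechet
  derivatives, so even the unspecified values agree. This gives access to iterated partial
  derivatives of functions for which the first partial derivative is known on an open set only.\<close>

lemma partial_deriv_cong_open:
  assumes "open S" "x \<in> S" "\<And>y. y \<in> S \<Longrightarrow> f y = g y"
  shows "partial_deriv i f x = partial_deriv i g x"
proof -
  have "(f has_derivative f') (at x) \<longleftrightarrow> (g has_derivative f') (at x)" for f'
    using assms has_derivative_transform_within_open[of f f' x UNIV S g]
      has_derivative_transform_within_open[of g f' x UNIV S f] by auto
  then show ?thesis by (simp add: partial_deriv_def frechet_derivative_def)
qed

lemma partial_deriv_add:
  assumes "f differentiable (at x)" "g differentiable (at x)"
  shows "partial_deriv i (\<lambda>y. f y + g y) x = partial_deriv i f x + partial_deriv i g x"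
  using assms
  by (intro partial_deriv_eqI[THEN trans])
     (auto simp: partial_deriv_def frechet_derivative_works intro!: derivative_eq_intros)

lemma partial_deriv_bounded_linear:
  assumes "bounded_linear h" "f differentiable (at x)"
  shows "partial_deriv i (\<lambda>y. h (f y)) x = h (partial_deriv i f x)"
  using assms
  by (intro partial_deriv_eqI[THEN trans, OF bounded_linear.has_derivative[OF assms(1)]])
     (auto simp: partial_deriv_def frechet_derivative_works)

lemma
  assumes "f differentiable (at (- x))"
  shows partial_deriv_reflect: "partial_deriv i (\<lambda>y. f (- y)) x = - partial_deriv i f (- x)"
    and differentiable_reflect: "(\<lambda>y. f (- y)) differentiable (at x)"
proof -
  let ?D = "frechet_derivative f (at (- x))"
  have D: "(f has_derivative ?D) (at (- x))"
    using assms by (simp add: frechet_derivative_works)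
  have "((\<lambda>y. f (- y)) has_derivative (\<lambda>d. ?D (- d))) (at x)"
    by (rule has_derivative_compose[of uminus uminus x UNIV f, OF _ D])
       (auto intro!: derivative_eq_intros)
  then show "partial_deriv i (\<lambda>y. f (- y)) x = - partial_deriv i f (- x)"
      and "(\<lambda>y. f (- y)) differentiable (at x)"
    using partial_deriv_eqI linear_neg[OF has_derivative_linear[OF D]]
    by (fastforce simp: partial_deriv_def[of i f], auto simp: differentiable_def)
qed

lemma Ck_on_cong:
  assumes "open S" "\<And>x. x \<in> S \<Longrightarrow> f x = g x" "Ck_on m S f"
  shows "Ck_on m S g"
  using assms(2,3)
proof (induction m arbitrary: f g)
  case 0
  then show ?case using continuous_on_cong[of S S f g] by simp
next
  case (Suc m)
  have "Ck_on m S (partial_deriv i g)" for i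
  proof (rule Suc.IH)
    show "partial_deriv i f x = partial_deriv i g x" if "x \<in> S" for x
      by (rule partial_deriv_cong_open[OF assms(1) that Suc.prems(1)])
    show "Ck_on m S (partial_deriv i f)" using Suc.prems(2) by simp
  qed
  moreover have "g differentiable (at x)" if "x \<in> S" for x
    using differentiable_cong_open[OF assms(1) that Suc.prems(1)] Suc.prems(2) that by simp
  ultimately show ?case by simp
qed

lemma Ck_on_add:
  assumes "open S" "Ck_on m S f" "Ck_on m S g"
  shows "Ck_on m S (\<lambda>x. f x + g x)"
  using assms(2,3)
proof (induction m arbitrary: f g)
  case 0
  then show ?case by (auto intro: continuous_intros)
next
  case (Suc m)
  have "Ck_on m S (partial_deriv i (\<lambda>x. f x + g x))" for i
    by (rule Ck_on_cong[OF assms(1) _ Suc.IH[of "partial_deriv i f" "partial_deriv i g"]])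
       (use Suc.prems in \<open>auto simp: partial_deriv_add\<close>)
  with Suc.prems show ?case by (auto intro: differentiable_add)
qed

lemma Ck_on_bounded_linear:
  assumes "open S" "bounded_linear h" "Ck_on m S f"
  shows "Ck_on m S (\<lambda>x. h (f x))"
  using assms(3)
proof (induction m arbitrary: f)
  case 0
  then show ?case by (auto intro: bounded_linear.continuous_on[OF assms(2)])
next
  case (Suc m)
  have "Ck_on m S (partial_deriv i (\<lambda>x. h (f x)))" for i
    by (rule Ck_on_cong[OF assms(1) _ Suc.IH[of "partial_deriv i f"]])
       (use Suc.prems in \<open>auto simp: partial_deriv_bounded_linear assms(2)\<close>)
  moreover have "(\<lambda>x. h (f x)) differentiable (at x)" if "x \<in> S" for x
  proof -
    have "(f has_derivative frechet_derivative f (at x)) (at x)"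
      using Suc.prems that by (simp add: frechet_derivative_works)
    from bounded_linear.has_derivative[OF assms(2) this] show ?thesis
      by (rule differentiableI)
  qed
  ultimately show ?case by simp
qed

text \<open>The set is reflected as well; no symmetry is assumed here, since this is also applied to
  defining functions near a single boundary point.\<close>

lemma Ck_on_reflect:
  assumes "open S" "Ck_on m S f"
  shows "Ck_on m (uminus ` S) (\<lambda>x. f (- x))"
  using assms(2)
proof (induction m arbitrary: f)
  case 0
  then show ?case by (auto intro!: continuous_intros continuous_on_compose2[of S f])
next
  case (Suc m)
  have op: "open (uminus ` S)" using assms(1) by (simp add: open_negations)
  have "Ck_on m (uminus ` S) (partial_deriv i (\<lambda>x. f (- x)))" for i
    by (rule Ck_on_cong[OF op _
          Ck_on_bounded_linear[OF op bounded_linear_minus[OF bounded_linear_ident]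
            Suc.IH[of "partial_deriv i f"]]])
       (use Suc.prems in \<open>auto simp: partial_deriv_reflect\<close>)
  with Suc.prems show ?case by (auto intro: differentiable_reflect)
qed

lemma Ck_on_imp_continuous_on: "Ck_on m S f \<Longrightarrow> continuous_on S f"
  by (cases m) (auto intro!: differentiable_imp_continuous_on simp: differentiable_on_def
      differentiable_at_withinI)

section \<open>The outer normal\<close>

lemma has_derivative_gradient:
  assumes "g differentiable (at x)"
  shows "(g has_derivative (\<lambda>d. gradient g x \<bullet> d)) (at x)"
proof -
  have "(\<lambda>d. \<Sum>i\<in>UNIV. d $ i *\<^sub>R partial_deriv i g x) = (\<lambda>d. gradient g x \<bullet> d)"
    by (simp add: gradient_def inner_vec_def mult.commute)
  with has_derivative_partial_deriv[OF assms] show ?thesis by simp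
qed

lemma local_defining_function_line:
  assumes "local_defining_function \<Omega> p U g"
  shows "((\<lambda>t. g (p + t *\<^sub>R d)) has_real_derivative gradient g p \<bullet> d) (at 0)"
    and "\<exists>e>0. \<forall>t. 0 < t \<and> t < e \<longrightarrow> p + t *\<^sub>R d \<in> U"
proof -
  have U: "open U" "p \<in> U" and "Ck_on 1 U g"
    using assms by (auto simp: local_defining_function_def smooth_on_def)
  then have D: "(g has_derivative (\<lambda>d. gradient g p \<bullet> d)) (at (p + 0 *\<^sub>R d))"
    by (auto intro: has_derivative_gradient)
  have "((\<lambda>t. g (p + t *\<^sub>R d)) has_derivative (\<lambda>t. gradient g p \<bullet> (t *\<^sub>R d))) (at 0)"
    by (rule has_derivative_compose[where f = "\<lambda>t. p + t *\<^sub>R d" and x = 0, OF _ D]) (auto intro!: derivative_eq_intros)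
  then show "((\<lambda>t. g (p + t *\<^sub>R d)) has_real_derivative gradient g p \<bullet> d) (at 0)"
    by (simp add: has_field_derivative_def mult_commute_abs)
  have "isCont (\<lambda>t. p + t *\<^sub>R d) 0" by (intro continuous_intros)
  then have "\<forall>\<^sub>F t in at 0. p + t *\<^sub>R d \<in> U"
    using U by (auto simp: isCont_def dest: topological_tendstoD)
  then obtain e where "e > 0" "\<forall>t. t \<noteq> 0 \<and> dist t 0 < e \<longrightarrow> p + t *\<^sub>R d \<in> U"
    by (auto simp: eventually_at)
  then show "\<exists>e>0. \<forall>t. 0 < t \<and> t < e \<longrightarrow> p + t *\<^sub>R d \<in> U"
    by (auto intro!: exI[of _ e])
qed

lemma local_defining_function_zero:
  assumes "open \<Omega>" "p \<in> frontier \<Omega>" "local_defining_function \<Omega> p U g"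
  shows "g p = 0"
proof -
  have U: "open U" "p \<in> U" "\<Omega> \<inter> U = {x\<in>U. g x < 0}" and "Ck_on 0 U g"
    using assms by (auto simp: local_defining_function_def smooth_on_def)
  then have "isCont g p" by (simp add: continuous_on_eq_continuous_at)
  have "\<not> g p > 0"
  proof
    assume "g p > 0"
    with \<open>isCont g p\<close> have "\<forall>\<^sub>F x in nhds p. g x > 0"
      by (intro order_tendstoD(1)[of g "g p"]) (simp_all add: isCont_def tendsto_at_iff_tendsto_nhds)
    moreover have "\<forall>\<^sub>F x in nhds p. x \<in> U" using U by (simp add: eventually_nhds_in_open)
    ultimately have "\<forall>\<^sub>F x in nhds p. x \<notin> \<Omega>"
      by eventually_elim (use U(3) in \<open>metis (mono_tags, lifting) IntI less_asym mem_Collect_eq\<close>)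
    then obtain V where "open V" "p \<in> V" "V \<inter> \<Omega> = {}" by (auto simp: eventually_nhds)
    moreover have "p \<in> closure \<Omega>" using assms(2) by (simp add: frontier_def)
    ultimately show False by (meson open_Int_closure_eq_empty disjoint_iff)
  qed
  moreover have "\<not> g p < 0"
    using U assms(1,2) by (auto simp: frontier_def interior_open)
  ultimately show ?thesis by simp
qed

text \<open>The next two lemmas compare the gradient of a defining function with the set itself, to
  first order: a direction of strict descent enters the set, and a direction entering the set is
  not one of strict ascent.\<close>

lemma local_defining_function_inward:
  assumes "open \<Omega>" "p \<in> frontier \<Omega>" "local_defining_function \<Omega> p U g" "gradient g p \<bullet> d < 0"
  shows "\<exists>e>0. \<forall>t. 0 < t \<and> t < e \<longrightarrow> p + t *\<^sub>R d \<in> \<Omega>"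
proof -
  obtain e1 where e1: "e1 > 0" "\<forall>t. 0 < t \<and> t < e1 \<longrightarrow> p + t *\<^sub>R d \<in> U"
    using local_defining_function_line(2)[OF assms(3)] by blast
  obtain e2 where e2: "e2 > 0" "\<forall>t>0. t < e2 \<longrightarrow> g (p + t *\<^sub>R d) < 0"
    using DERIV_neg_dec_right[OF local_defining_function_line(1)[OF assms(3)] assms(4)]
      local_defining_function_zero[OF assms(1-3)] by auto
  have "p + t *\<^sub>R d \<in> \<Omega>" if "0 < t" "t < min e1 e2" for t
  proof -
    have "p + t *\<^sub>R d \<in> {x\<in>U. g x < 0}" using e1 e2 that by auto
    then show ?thesis using assms(3) unfolding local_defining_function_def by blast
  qed
  with e1(1) e2(1) show ?thesis by (auto intro!: exI[of _ "min e1 e2"])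
qed

lemma local_defining_function_not_outward:
  assumes "open \<Omega>" "p \<in> frontier \<Omega>" "local_defining_function \<Omega> p U g"
    and "e > 0" "\<forall>t. 0 < t \<and> t < e \<longrightarrow> p + t *\<^sub>R d \<in> \<Omega>"
  shows "gradient g p \<bullet> d \<le> 0"
proof (rule ccontr)
  assume "\<not> gradient g p \<bullet> d \<le> 0"
  then obtain e2 where e2: "e2 > 0" "\<forall>t>0. t < e2 \<longrightarrow> g (p + t *\<^sub>R d) > 0"
    using DERIV_pos_inc_right[OF local_defining_function_line(1)[OF assms(3)], of d]
      local_defining_function_zero[OF assms(1-3)] by auto
  obtain e1 where e1: "e1 > 0" "\<forall>t. 0 < t \<and> t < e1 \<longrightarrow> p + t *\<^sub>R d \<in> U"
    using local_defining_function_line(2)[OF assms(3)] by blast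
  define t where "t = min e (min e1 e2) / 2"
  have t: "0 < t" "t < e" "t < e1" "t < e2"
    using assms(4) e1(1) e2(1) by (auto simp: t_def min_def)
  then have "p + t *\<^sub>R d \<in> \<Omega> \<inter> U" "g (p + t *\<^sub>R d) > 0" using assms(5) e1 e2 by auto
  moreover have "\<Omega> \<inter> U = {x\<in>U. g x < 0}"
    using assms(3) by (simp add: local_defining_function_def)
  ultimately show False by (simp only:) simp
qed

text \<open>Nested half-spaces have the same unit normal.\<close>

lemma sgn_eq_sgnI:
  fixes a b :: "'a::real_inner"
  assumes "a \<noteq> 0" "b \<noteq> 0" "\<And>d. a \<bullet> d < 0 \<Longrightarrow> b \<bullet> d \<le> 0"
  shows "sgn a = sgn b"
proof (rule ccontr)
  assume neq: "sgn a \<noteq> sgn b"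
  have unit: "sgn a \<bullet> sgn a = 1" "sgn b \<bullet> sgn b = 1"
    using assms(1,2) by (auto simp: norm_sgn dot_square_norm)
  have "0 < (sgn a - sgn b) \<bullet> (sgn a - sgn b)" using neq by simp
  then have lt: "sgn a \<bullet> sgn b < 1"
    using unit by (simp add: inner_diff_left inner_diff_right inner_commute)
  have "a = norm a *\<^sub>R sgn a" "b = norm b *\<^sub>R sgn b"
    using assms(1,2) by (simp_all add: sgn_div_norm)
  then have eq: "a \<bullet> (sgn b - sgn a) = norm a * (sgn a \<bullet> sgn b - 1)"
      "b \<bullet> (sgn b - sgn a) = norm b * (1 - sgn a \<bullet> sgn b)"
    by (metis inner_scaleR_left inner_diff_right inner_commute unit)+
  \<comment> \<open>The direction \<open>sgn b - sgn a\<close> contradicts the hypothesis.\<close>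
  have "a \<bullet> (sgn b - sgn a) < 0" "b \<bullet> (sgn b - sgn a) > 0"
    unfolding eq using lt assms(1,2) by (simp_all add: mult_pos_neg)
  then show False using assms(3) by fastforce
qed

text \<open>The description defining \<^const>\<open>outer_normal\<close> is uniquely satisfied: descent directions
  of one defining function enter the set, hence are not ascent directions of any other one.\<close>

lemma outer_normal_eq:
  assumes "open \<Omega>" "p \<in> frontier \<Omega>" "local_defining_function \<Omega> p U g"
  shows "outer_normal \<Omega> p = sgn (gradient g p)"
  unfolding outer_normal_def
proof (rule the_equality)
  show "\<exists>U g'. local_defining_function \<Omega> p U g' \<and> sgn (gradient g p) = sgn (gradient g' p)"
    using assms(3) by blast
next
  fix \<nu> assume "\<exists>U g. local_defining_function \<Omega> p U g \<and> \<nu> = sgn (gradient g p)"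
  then obtain V h where h: "local_defining_function \<Omega> p V h" "\<nu> = sgn (gradient h p)" by blast
  have "gradient g p \<bullet> d \<le> 0" if "gradient h p \<bullet> d < 0" for d
    using local_defining_function_inward[OF assms(1,2) h(1) that]
      local_defining_function_not_outward[OF assms] by blast
  with h assms(3) show "\<nu> = sgn (gradient g p)"
    by (auto simp: local_defining_function_def intro!: sgn_eq_sgnI)
qed

lemma outer_normal_inward:
  assumes "open \<Omega>" "smooth_boundary \<Omega>" "p \<in> frontier \<Omega>"
  shows "\<exists>e>0. \<forall>t. - e < t \<and> t < 0 \<longrightarrow> p + t *\<^sub>R outer_normal \<Omega> p \<in> \<Omega>"
proof -
  obtain U g where g: "local_defining_function \<Omega> p U g"
    using assms unfolding smooth_boundary_def by blast
  then have "gradient g p \<noteq> 0" by (simp add: local_defining_function_def)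
  then have "gradient g p \<bullet> (- outer_normal \<Omega> p) < 0"
    by (simp add: outer_normal_eq[OF assms(1,3) g] sgn_div_norm)
  then obtain e where "e > 0" "\<forall>t. 0 < t \<and> t < e \<longrightarrow> p + t *\<^sub>R (- outer_normal \<Omega> p) \<in> \<Omega>"
    using local_defining_function_inward[OF assms(1,3) g] by blast
  then have "p + t *\<^sub>R outer_normal \<Omega> p \<in> \<Omega>" if "- e < t" "t < 0" for t
    using that by (metis minus_less_iff neg_0_less_iff_less scaleR_minus_left scaleR_minus_right minus_minus)
  with \<open>e > 0\<close> show ?thesis by blast
qed

section \<open>Linear combinations and reflections of functions on a symmetric domain\<close>

lemma partial_deriv_lincomb:
  fixes f g :: "real^'n::finite \<Rightarrow> complex"
  assumes "f differentiable (at x)" "g differentiable (at x)"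
  shows "partial_deriv i (\<lambda>y. a * f y + b * g y) x = a * partial_deriv i f x + b * partial_deriv i g x"
    and "(\<lambda>y. a * f y + b * g y) differentiable (at x)"
proof -
  have diff: "(\<lambda>y. a * f y) differentiable (at x)" "(\<lambda>y. b * g y) differentiable (at x)"
    by (intro differentiable_mult differentiable_const assms)+
  show "(\<lambda>y. a * f y + b * g y) differentiable (at x)"
    by (rule differentiable_add[OF diff])
  show "partial_deriv i (\<lambda>y. a * f y + b * g y) x = a * partial_deriv i f x + b * partial_deriv i g x"
    unfolding partial_deriv_add[OF diff]
    by (simp only: partial_deriv_bounded_linear[OF bounded_linear_mult_right assms(1)]
        partial_deriv_bounded_linear[OF bounded_linear_mult_right assms(2)])
qed

lemma Ck_on_lincomb:
  fixes f g :: "real^'n::finite \<Rightarrow> complex"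
  assumes "open S" "Ck_on m S f" "Ck_on m S g"
  shows "Ck_on m S (\<lambda>y. a * f y + b * g y)"
  by (rule Ck_on_add[OF assms(1) Ck_on_bounded_linear[OF assms(1) bounded_linear_mult_right assms(2)]
        Ck_on_bounded_linear[OF assms(1) bounded_linear_mult_right assms(3)]])

lemma Ck_on_2_iff:
  "Ck_on 2 S u \<longleftrightarrow> (\<forall>x\<in>S. u differentiable (at x)) \<and>
     (\<forall>i. \<forall>x\<in>S. partial_deriv i u differentiable (at x)) \<and>
     (\<forall>i j. continuous_on S (partial_deriv j (partial_deriv i u)))"
  by (auto simp: numeral_2_eq_2)

lemma second_partial_deriv_lincomb:
  fixes u v :: "real^'n::finite \<Rightarrow> complex"
  assumes "open S" "Ck_on 2 S u" "Ck_on 2 S v" "x \<in> S"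
  shows "partial_deriv j (partial_deriv i (\<lambda>y. a * u y + b * v y)) x
       = a * partial_deriv j (partial_deriv i u) x + b * partial_deriv j (partial_deriv i v) x"
proof -
  have "partial_deriv j (partial_deriv i (\<lambda>y. a * u y + b * v y)) x
      = partial_deriv j (\<lambda>y. a * partial_deriv i u y + b * partial_deriv i v y) x"
    using assms(2,3)
    by (intro partial_deriv_cong_open[OF assms(1,4)] partial_deriv_lincomb)
       (auto simp: Ck_on_2_iff)
  also have "\<dots> = a * partial_deriv j (partial_deriv i u) x + b * partial_deriv j (partial_deriv i v) x"
    using assms(2-4) by (intro partial_deriv_lincomb) (auto simp: Ck_on_2_iff)
  finally show ?thesis .
qed

lemma laplacian_lincomb:
  fixes u v :: "real^'n::finite \<Rightarrow> complex"
  assumes "open S" "Ck_on 2 S u" "Ck_on 2 S v" "x \<in> S"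
  shows "laplacian (\<lambda>y. a * u y + b * v y) x = a * laplacian u x + b * laplacian v x"
  by (simp add: laplacian_def second_partial_deriv_lincomb[OF assms] sum.distrib sum_distrib_left)

lemma continuous_on_laplacian:
  "Ck_on 2 S u \<Longrightarrow> continuous_on S (laplacian u)"
  unfolding laplacian_def by (intro continuous_intros) (auto simp: Ck_on_2_iff)

lemma extends_continuously_cong:
  assumes "\<And>x. x \<in> \<Omega> \<Longrightarrow> f x = g x" "extends_continuously \<Omega> f"
  shows "extends_continuously \<Omega> g"
  using assms unfolding extends_continuously_def by auto

lemma extends_continuously_lincomb:
  assumes "extends_continuously \<Omega> f" "extends_continuously \<Omega> g"
  shows "extends_continuously \<Omega> (\<lambda>x. a * f x + b * g x)"
proof -
  obtain h k where "continuous_on (closure \<Omega>) h" "\<forall>x\<in>\<Omega>. h x = f x"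
      "continuous_on (closure \<Omega>) k" "\<forall>x\<in>\<Omega>. k x = g x"
    using assms unfolding extends_continuously_def by blast
  then show ?thesis unfolding extends_continuously_def
    by (intro exI[of _ "\<lambda>x. a * h x + b * k x"]) (auto intro!: continuous_intros)
qed

lemma holder_on_cong:
  assumes "\<And>x. x \<in> \<Omega> \<Longrightarrow> f x = g x" "holder_on \<alpha> \<Omega> f"
  shows "holder_on \<alpha> \<Omega> g"
  using assms unfolding holder_on_def by auto

lemma holder_on_lincomb:
  assumes "holder_on \<alpha> \<Omega> f" "holder_on \<alpha> \<Omega> g"
  shows "holder_on \<alpha> \<Omega> (\<lambda>x. a * f x + b * g x)"
proof -
  obtain C where C: "\<And>x y. x \<in> \<Omega> \<Longrightarrow> y \<in> \<Omega> \<Longrightarrow> norm (f x - f y) \<le> C * dist x y powr \<alpha>"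
    using assms(1) unfolding holder_on_def by blast
  obtain D where D: "\<And>x y. x \<in> \<Omega> \<Longrightarrow> y \<in> \<Omega> \<Longrightarrow> norm (g x - g y) \<le> D * dist x y powr \<alpha>"
    using assms(2) unfolding holder_on_def by blast
  have "norm (a * f x + b * g x - (a * f y + b * g y))
      \<le> (norm a * C + norm b * D) * dist x y powr \<alpha>" if "x \<in> \<Omega>" "y \<in> \<Omega>" for x y
  proof -
    have "norm (a * f x + b * g x - (a * f y + b * g y))
        = norm (a * (f x - f y) + b * (g x - g y))" by (simp add: algebra_simps)
    also have "\<dots> \<le> norm a * norm (f x - f y) + norm b * norm (g x - g y)"
      by (metis norm_mult norm_triangle_ineq)
    also have "\<dots> \<le> norm a * (C * dist x y powr \<alpha>) + norm b * (D * dist x y powr \<alpha>)"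
      using C D that by (intro add_mono mult_left_mono) auto
    finally show ?thesis by (simp add: algebra_simps)
  qed
  then show ?thesis unfolding holder_on_def by blast
qed

lemma C2_holder_lincomb:
  assumes "open \<Omega>" and u: "u \<in> C2_holder \<alpha> \<Omega>" and v: "v \<in> C2_holder \<alpha> \<Omega>"
  shows "(\<lambda>x. a * u x + b * v x) \<in> C2_holder \<alpha> \<Omega>"
proof -
  let ?L = "\<lambda>x. a * u x + b * v x"
  have C2: "Ck_on 2 \<Omega> u" "Ck_on 2 \<Omega> v" using u v by (auto simp: C2_holder_def)
  have d1: "partial_deriv i ?L x = a * partial_deriv i u x + b * partial_deriv i v x"
    if "x \<in> \<Omega>" for i x
    using C2 that by (intro partial_deriv_lincomb) (auto simp: Ck_on_2_iff)
  note d2 = second_partial_deriv_lincomb[OF assms(1) C2]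
  have "extends_continuously \<Omega> (partial_deriv i ?L)" for i
    by (rule extends_continuously_cong[OF d1[symmetric]], assumption, rule extends_continuously_lincomb)
       (use u v in \<open>auto simp: C2_holder_def\<close>)
  moreover have "extends_continuously \<Omega> (partial_deriv j (partial_deriv i ?L))" for i j
    by (rule extends_continuously_cong[OF d2[symmetric]], assumption, rule extends_continuously_lincomb)
       (use u v in \<open>auto simp: C2_holder_def\<close>)
  moreover have "holder_on \<alpha> \<Omega> (partial_deriv j (partial_deriv i ?L))" for i j
    by (rule holder_on_cong[OF d2[symmetric]], assumption, rule holder_on_lincomb)
       (use u v in \<open>auto simp: C2_holder_def\<close>)
  moreover have "Ck_on 2 \<Omega> ?L" by (rule Ck_on_lincomb[OF assms(1) C2])
  moreover have "continuous_on (closure \<Omega>) ?L"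
    using u v by (auto simp: C2_holder_def intro!: continuous_intros)
  ultimately show ?thesis using u v by (simp add: C2_holder_def)
qed

lemma partial_deriv_zero: "partial_deriv i (\<lambda>_. 0) = (\<lambda>_. 0)"
  by (rule ext, rule partial_deriv_eqI[THEN trans, OF has_derivative_const]) simp

lemma zero_in_C2_holder: "(\<lambda>_. 0) \<in> C2_holder \<alpha> \<Omega>"
proof -
  have "extends_continuously \<Omega> (\<lambda>_. 0)"
    unfolding extends_continuously_def by (intro exI[of _ "\<lambda>_. 0"]) auto
  moreover have "holder_on \<alpha> \<Omega> (\<lambda>_. 0)"
    unfolding holder_on_def by (intro exI[of _ 0]) auto
  ultimately show ?thesis
    by (simp add: C2_holder_def partial_deriv_zero Ck_on_2_iff)
qed

text \<open>The part of \<open>u\<close> of parity \<open>s\<close>, i.e. the even part for \<open>s = 1\<close> and the odd part for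
  \<open>s = - 1\<close>. With the parity as a number both parts are one linear combination of \<open>u\<close> and its
  reflection.\<close>

definition parity_part :: "complex \<Rightarrow> (real^'n::finite \<Rightarrow> complex) \<Rightarrow> real^'n \<Rightarrow> complex" where
  "parity_part s u = (\<lambda>x. 1/2 * u x + s/2 * u (- x))"

lemma parity_part_apply: "parity_part s u x = u x / 2 + s * u (- x) / 2"
  by (simp add: parity_part_def)

lemma parity_part_eqI:
  assumes "u x = s * u (- x)"
  shows "parity_part s u x = u x"
  using assms by (simp add: parity_part_def)

lemma even_part_plus_odd_part: "parity_part 1 u x + parity_part (- 1) u x = u x"
  by (simp add: parity_part_def field_simps)

text \<open>An open set with smooth boundary that is symmetric about the origin.\<close>

locale symmetric_smooth_domain =
  fixes \<Omega> :: "(real^'n::finite) set"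
  assumes open_domain: "open \<Omega>"
    and smooth: "smooth_boundary \<Omega>"
    and symmetric: "x \<in> \<Omega> \<Longrightarrow> - x \<in> \<Omega>"
begin

lemma reflect_mem_iff [simp]: "- x \<in> \<Omega> \<longleftrightarrow> x \<in> \<Omega>"
  using symmetric[of x] symmetric[of "- x"] by auto

lemma uminus_domain: "uminus ` \<Omega> = \<Omega>"
proof (intro equalityI subsetI)
  show "x \<in> uminus ` \<Omega>" if "x \<in> \<Omega>" for x
    using that by (intro image_eqI[of _ _ "- x"]) auto
qed auto

lemma closure_reflect_iff [simp]: "- x \<in> closure \<Omega> \<longleftrightarrow> x \<in> closure \<Omega>"
proof -
  have "uminus ` closure \<Omega> \<subseteq> closure (uminus ` \<Omega>)"
    by (intro closure_bounded_linear_image_subset bounded_linear_minus bounded_linear_ident)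
  then have "- y \<in> closure \<Omega>" if "y \<in> closure \<Omega>" for y
    using that uminus_domain by auto
  from this[of x] this[of "- x"] show ?thesis by auto
qed

lemma frontier_reflect_iff [simp]: "- x \<in> frontier \<Omega> \<longleftrightarrow> x \<in> frontier \<Omega>"
  by (simp add: frontier_def interior_open[OF open_domain])

lemma outer_normal_reflect:
  assumes "p \<in> frontier \<Omega>"
  shows "outer_normal \<Omega> (- p) = - outer_normal \<Omega> p"
proof -
  obtain U g where g: "local_defining_function \<Omega> p U g"
    using assms smooth unfolding smooth_boundary_def by blast
  then have U: "open U" "p \<in> U" "smooth_on U g" "\<forall>x\<in>U. gradient g x \<noteq> 0"
      "\<Omega> \<inter> U = {x\<in>U. g x < 0}"
    by (auto simp: local_defining_function_def)
  have "Ck_on 1 U g" using U(3) by (simp add: smooth_on_def)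
  then have grad: "gradient (\<lambda>x. g (- x)) x = - gradient g (- x)" if "- x \<in> U" for x
    using that by (simp add: gradient_def vec_eq_iff partial_deriv_reflect)
  have "local_defining_function \<Omega> (- p) (uminus ` U) (\<lambda>x. g (- x))"
    unfolding local_defining_function_def
  proof (intro conjI ballI)
    show "open (uminus ` U)" using U(1) by (rule open_negations)
    show "- p \<in> uminus ` U" using U(2) by blast
    show "smooth_on (uminus ` U) (\<lambda>x. g (- x))"
      using U(1,3) Ck_on_reflect by (auto simp: smooth_on_def)
    show "gradient (\<lambda>x. g (- x)) x \<noteq> 0" if "x \<in> uminus ` U" for x
      using that U(4) grad by auto
    show "\<Omega> \<inter> uminus ` U = {x \<in> uminus ` U. g (- x) < 0}" (is "?A = ?B")
    proof (rule set_eqI)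
      fix x
      have "x \<in> ?A \<longleftrightarrow> - x \<in> \<Omega> \<inter> U" by (auto simp: image_iff) (metis minus_minus)
      also have "\<dots> \<longleftrightarrow> x \<in> ?B" unfolding U(5) by (auto simp: image_iff) (metis minus_minus)
      finally show "x \<in> ?A \<longleftrightarrow> x \<in> ?B" .
    qed
  qed
  then have "outer_normal \<Omega> (- p) = sgn (gradient (\<lambda>x. g (- x)) (- p))"
    using assms by (intro outer_normal_eq[OF open_domain]) auto
  then show ?thesis
    using U(2) by (simp add: grad sgn_minus outer_normal_eq[OF open_domain assms g])
qed

text \<open>Reflection changes the sign of first partial derivatives and preserves second ones.\<close>

lemma C2_holder_reflect:
  assumes u: "u \<in> C2_holder \<alpha> \<Omega>"
  shows "(\<lambda>x. u (- x)) \<in> C2_holder \<alpha> \<Omega>"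
    and "x \<in> \<Omega> \<Longrightarrow> laplacian (\<lambda>x. u (- x)) x = laplacian u (- x)"
proof -
  let ?R = "\<lambda>x. u (- x)"
  have C2: "Ck_on 2 \<Omega> u" using u by (auto simp: C2_holder_def)
  have d1: "partial_deriv i ?R x = - partial_deriv i u (- x)" if "x \<in> \<Omega>" for i x
    using C2 that by (intro partial_deriv_reflect) (auto simp: Ck_on_2_iff)
  have d2: "partial_deriv j (partial_deriv i ?R) x = partial_deriv j (partial_deriv i u) (- x)"
    if "x \<in> \<Omega>" for i j x
  proof -
    have diff: "partial_deriv i u differentiable (at (- x))"
      using C2 that by (auto simp: Ck_on_2_iff)
    have "partial_deriv j (partial_deriv i ?R) x = partial_deriv j (\<lambda>y. - partial_deriv i u (- y)) x"
      by (rule partial_deriv_cong_open[OF open_domain that d1])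
    also have "\<dots> = - partial_deriv j (\<lambda>y. partial_deriv i u (- y)) x"
      by (rule partial_deriv_bounded_linear[OF bounded_linear_minus[OF bounded_linear_ident]
            differentiable_reflect[OF diff]])
    also have "\<dots> = partial_deriv j (partial_deriv i u) (- x)"
      by (simp add: partial_deriv_reflect[OF diff])
    finally show ?thesis .
  qed
  show "laplacian ?R x = laplacian u (- x)" if "x \<in> \<Omega>" for x
    by (simp add: laplacian_def d2[OF that])
  have cont: "continuous_on (closure \<Omega>) (\<lambda>x. h (- x))" if "continuous_on (closure \<Omega>) h" for h :: "_ \<Rightarrow> complex"
    by (rule continuous_on_compose2[OF that, of _ uminus]) (auto intro!: continuous_intros)
  have ext: "extends_continuously \<Omega> (\<lambda>x. f (- x))" if f: "extends_continuously \<Omega> f" for f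
  proof -
    obtain h where "continuous_on (closure \<Omega>) h" "\<forall>x\<in>\<Omega>. h x = f x"
      using f unfolding extends_continuously_def by blast
    then show ?thesis unfolding extends_continuously_def
      by (intro exI[of _ "\<lambda>x. h (- x)"]) (simp add: cont)
  qed
  have hol: "holder_on \<alpha> \<Omega> (\<lambda>x. f (- x))" if f: "holder_on \<alpha> \<Omega> f" for f
  proof -
    obtain C where "\<forall>x\<in>\<Omega>. \<forall>y\<in>\<Omega>. norm (f x - f y) \<le> C * dist x y powr \<alpha>"
      using f unfolding holder_on_def by blast
    then have "\<forall>x\<in>\<Omega>. \<forall>y\<in>\<Omega>. norm (f (- x) - f (- y)) \<le> C * dist x y powr \<alpha>"
      by (metis dist_minus symmetric)
    then show ?thesis unfolding holder_on_def by blast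
  qed
  have "extends_continuously \<Omega> (partial_deriv i ?R)" for i
  proof -
    have "extends_continuously \<Omega> (\<lambda>x. (- 1) * partial_deriv i u (- x) + 0 * partial_deriv i u (- x))"
      by (rule extends_continuously_lincomb[OF ext ext]) (use u in \<open>auto simp: C2_holder_def\<close>)
    then show ?thesis by (rule extends_continuously_cong[rotated]) (simp add: d1)
  qed
  moreover have "extends_continuously \<Omega> (partial_deriv j (partial_deriv i ?R))" for i j
    by (rule extends_continuously_cong[OF d2[symmetric]], assumption, rule ext)
       (use u in \<open>auto simp: C2_holder_def\<close>)
  moreover have "holder_on \<alpha> \<Omega> (partial_deriv j (partial_deriv i ?R))" for i j
    by (rule holder_on_cong[OF d2[symmetric]], assumption, rule hol)
       (use u in \<open>auto simp: C2_holder_def\<close>)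
  moreover have "Ck_on 2 \<Omega> ?R" using Ck_on_reflect[OF open_domain C2] uminus_domain by simp
  ultimately show "?R \<in> C2_holder \<alpha> \<Omega>" using u by (simp add: C2_holder_def cont)
qed

text \<open>Existence of the one-sided normal derivative, without which \<^const>\<open>normal_deriv\<close> would
  not be linear. A function of the class need not be differentiable across the boundary, but its
  gradient extends continuously to the closure. On a segment ending at the boundary point in the
  normal direction the function is therefore the integral of a continuous function.\<close>

lemma has_normal_deriv:
  assumes u: "u \<in> C2_holder \<alpha> \<Omega>" and p: "p \<in> frontier \<Omega>"
  shows "((\<lambda>t. u (p + t *\<^sub>R outer_normal \<Omega> p)) has_vector_derivative normal_deriv \<Omega> u p)
    (at 0 within {..0})"
proof -
  define \<nu> where "\<nu> = outer_normal \<Omega> p"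
  define \<phi> where "\<phi> = (\<lambda>t. u (p + t *\<^sub>R \<nu>))"
  obtain e where e: "e > 0" "\<And>t. - e < t \<Longrightarrow> t < 0 \<Longrightarrow> p + t *\<^sub>R \<nu> \<in> \<Omega>"
    using outer_normal_inward[OF open_domain smooth p] unfolding \<nu>_def by blast
  define a where "a = - e / 2"
  have a: "a < 0" "\<And>t. a \<le> t \<Longrightarrow> t < 0 \<Longrightarrow> p + t *\<^sub>R \<nu> \<in> \<Omega>"
    using e by (auto simp: a_def)
  have seg: "p + t *\<^sub>R \<nu> \<in> closure \<Omega>" if "t \<in> {a..0}" for t
    using a(2)[of t] that p closure_subset[of \<Omega>] by (cases "t = 0") (auto simp: frontier_def)
  have "\<forall>i. \<exists>h. continuous_on (closure \<Omega>) h \<and> (\<forall>x\<in>\<Omega>. h x = partial_deriv i u x)"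
    using u by (auto simp: C2_holder_def extends_continuously_def)
  then obtain H where H: "\<And>i. continuous_on (closure \<Omega>) (H i)"
      "\<And>i x. x \<in> \<Omega> \<Longrightarrow> H i x = partial_deriv i u x"
    by metis
  \<comment> \<open>The derivative along the segment, continuous up to the boundary point.\<close>
  define \<psi> where "\<psi> = (\<lambda>t. \<Sum>i\<in>UNIV. \<nu> $ i *\<^sub>R H i (p + t *\<^sub>R \<nu>))"
  have "continuous_on {a..0} (\<lambda>t. p + t *\<^sub>R \<nu>)" by (intro continuous_intros)
  then have cont: "continuous_on {a..0} (\<lambda>t. h (p + t *\<^sub>R \<nu>))"
    if "continuous_on (closure \<Omega>) h" for h :: "_ \<Rightarrow> complex"
    by (rule continuous_on_compose2[OF that]) (use seg in auto)
  have \<phi>_cont: "continuous_on {a..0} \<phi>"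
    unfolding \<phi>_def by (rule cont) (use u in \<open>simp add: C2_holder_def\<close>)
  have \<psi>_cont: "continuous_on {a..0} \<psi>"
    unfolding \<psi>_def by (intro continuous_intros cont H)
  have deriv: "(\<phi> has_vector_derivative \<psi> t) (at t)" if "t \<in> {a<..<0}" for t
  proof -
    have in_dom: "p + t *\<^sub>R \<nu> \<in> \<Omega>" using a(2) that by auto
    then have "u differentiable (at (p + t *\<^sub>R \<nu>))"
      using u by (auto simp: C2_holder_def Ck_on_2_iff)
    note D = has_derivative_partial_deriv[OF this]
    have "(\<phi> has_derivative (\<lambda>s. \<Sum>i\<in>UNIV. (s *\<^sub>R \<nu>) $ i *\<^sub>R partial_deriv i u (p + t *\<^sub>R \<nu>))) (at t)"
      unfolding \<phi>_def
      by (rule has_derivative_compose[where f = "\<lambda>t. p + t *\<^sub>R \<nu>" and x = t, OF _ D])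
         (auto intro!: derivative_eq_intros)
    then show ?thesis
      by (simp add: has_vector_derivative_def \<psi>_def H(2)[OF in_dom] scaleR_sum_right)
  qed
  have \<phi>_eq: "\<phi> t = \<phi> a + integral {a..t} \<psi>" if "t \<in> {a..0}" for t
  proof -
    have "(\<psi> has_integral (\<phi> t - \<phi> a)) {a..t}"
      using that
      by (intro fundamental_theorem_of_calculus_interior deriv continuous_on_subset[OF \<phi>_cont]) auto
    then show ?thesis by (simp add: integral_unique)
  qed
  have "((\<lambda>t. \<phi> a + integral {a..t} \<psi>) has_vector_derivative \<psi> 0) (at 0 within {a..0})"
    using integral_has_vector_derivative[OF \<psi>_cont, of 0] a(1)
    by (auto intro!: derivative_eq_intros)
  then have "(\<phi> has_vector_derivative \<psi> 0) (at 0 within {a..0})"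
    by (rule has_vector_derivative_transform[rotated 2]) (use a(1) in \<open>auto intro: \<phi>_eq\<close>)
  moreover have "at 0 within {a..0} = at 0 within {..0}"
    using a(1) by (intro at_within_nhd[of _ "{a<..}"]) auto
  ultimately have "\<phi> differentiable (at 0 within {..0})"
    by (auto intro: differentiableI_vector)
  then show ?thesis
    by (simp add: vector_derivative_works normal_deriv_def \<phi>_def \<nu>_def)
qed

lemma normal_deriv_lincomb:
  assumes "u \<in> C2_holder \<alpha> \<Omega>" "v \<in> C2_holder \<alpha> \<Omega>" "p \<in> frontier \<Omega>"
  shows "normal_deriv \<Omega> (\<lambda>x. a * u x + b * v x) p = a * normal_deriv \<Omega> u p + b * normal_deriv \<Omega> v p"
proof (rule vector_derivative_unique_within)
  show "at (0::real) within {..0} \<noteq> bot"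
    by (metis at_le bot.extremum_uniqueI lessThan_subset_iff trivial_limit_at_left_real
        less_imp_le lessThan_def atMost_def Collect_mono)
  show "((\<lambda>t. a * u (p + t *\<^sub>R outer_normal \<Omega> p) + b * v (p + t *\<^sub>R outer_normal \<Omega> p))
      has_vector_derivative normal_deriv \<Omega> (\<lambda>x. a * u x + b * v x) p) (at 0 within {..0})"
    using has_normal_deriv[OF C2_holder_lincomb[OF open_domain assms(1,2)] assms(3)] by simp
  show "((\<lambda>t. a * u (p + t *\<^sub>R outer_normal \<Omega> p) + b * v (p + t *\<^sub>R outer_normal \<Omega> p))
      has_vector_derivative a * normal_deriv \<Omega> u p + b * normal_deriv \<Omega> v p) (at 0 within {..0})"
    by (intro has_vector_derivative_add has_vector_derivative_mult_right has_normal_deriv[OF assms(1,3)]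
        has_normal_deriv[OF assms(2,3)])
qed

text \<open>The outer normals at opposite boundary points are opposite, so reflecting a function
  exchanges the outer normal derivatives at these points without a sign.\<close>

lemma normal_deriv_reflect:
  "p \<in> frontier \<Omega> \<Longrightarrow> normal_deriv \<Omega> (\<lambda>x. u (- x)) p = normal_deriv \<Omega> u (- p)"
  by (simp add: normal_deriv_def outer_normal_reflect)

lemma parity_part_C2_holder: "u \<in> C2_holder \<alpha> \<Omega> \<Longrightarrow> parity_part s u \<in> C2_holder \<alpha> \<Omega>"
  unfolding parity_part_def
  by (rule C2_holder_lincomb[OF open_domain _ C2_holder_reflect(1)])

lemma laplacian_parity_part:
  assumes "u \<in> C2_holder \<alpha> \<Omega>" "x \<in> \<Omega>"
  shows "laplacian (parity_part s u) x = parity_part s (laplacian u) x"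
proof -
  have "Ck_on 2 \<Omega> u" "Ck_on 2 \<Omega> (\<lambda>x. u (- x))"
    using assms C2_holder_reflect(1)[OF assms(1)] by (auto simp: C2_holder_def)
  from laplacian_lincomb[OF open_domain this assms(2)] show ?thesis
    unfolding parity_part_def by (simp only: C2_holder_reflect(2)[OF assms])
qed

lemma normal_deriv_parity_part:
  assumes "u \<in> C2_holder \<alpha> \<Omega>" "p \<in> frontier \<Omega>"
  shows "normal_deriv \<Omega> (parity_part s u) p = parity_part s (normal_deriv \<Omega> u) p"
  using normal_deriv_lincomb[OF assms(1) C2_holder_reflect(1)[OF assms(1)] assms(2)]
  unfolding parity_part_def by (simp only: normal_deriv_reflect[OF assms(2)])

section \<open>Parity and the boundary conditions\<close>

text \<open>The boundary conditions are invariant under exchanging \<open>x\<close> and \<open>- x\<close>, hence hold on the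
  whole boundary and do not depend on the coordinate \<open>k\<close>.\<close>

lemma problem_P_domain_iff:
  "u \<in> problem_P_domain k \<alpha> \<Omega> \<longleftrightarrow> u \<in> C2_holder \<alpha> \<Omega> \<and>
     (\<forall>x\<in>frontier \<Omega>. u x = - u (- x) \<and> normal_deriv \<Omega> u x = normal_deriv \<Omega> u (- x))"
    (is "_ \<longleftrightarrow> _ \<and> (\<forall>x\<in>_. ?bc x)")
proof -
  have "?bc x" if "\<forall>y\<in>frontier \<Omega> \<inter> {y. y $ k \<ge> 0}. ?bc y" "x \<in> frontier \<Omega>" for x
  proof (cases "x $ k \<ge> 0")
    case True
    then show ?thesis using that by blast
  next
    case False
    then have "- x \<in> frontier \<Omega> \<inter> {y. y $ k \<ge> 0}" using that(2) by simp
    then have "?bc (- x)" using that(1) by blast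
    then show ?thesis by simp
  qed
  then show ?thesis unfolding problem_P_domain_def by blast
qed

lemma problem_P_domainD:
  assumes "u \<in> problem_P_domain k \<alpha> \<Omega>"
  shows "u \<in> C2_holder \<alpha> \<Omega>"
    and "x \<in> frontier \<Omega> \<Longrightarrow> u x = - u (- x)"
    and "x \<in> frontier \<Omega> \<Longrightarrow> normal_deriv \<Omega> u x = normal_deriv \<Omega> u (- x)"
  using assms unfolding problem_P_domain_iff by blast+

lemma problem_P_domain_lincomb:
  assumes "u \<in> problem_P_domain k \<alpha> \<Omega>" "v \<in> problem_P_domain k \<alpha> \<Omega>"
  shows "(\<lambda>x. a * u x + b * v x) \<in> problem_P_domain k \<alpha> \<Omega>"
proof -
  have C2: "u \<in> C2_holder \<alpha> \<Omega>" "v \<in> C2_holder \<alpha> \<Omega>"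
    using assms by (auto dest: problem_P_domainD(1))
  have "a * u x + b * v x = - (a * u (- x) + b * v (- x))" if "x \<in> frontier \<Omega>" for x
    unfolding problem_P_domainD(2)[OF assms(1) that] problem_P_domainD(2)[OF assms(2) that] by simp
  moreover have "normal_deriv \<Omega> (\<lambda>x. a * u x + b * v x) x
      = normal_deriv \<Omega> (\<lambda>x. a * u x + b * v x) (- x)" if "x \<in> frontier \<Omega>" for x
    using that problem_P_domainD(3)[OF assms(1) that] problem_P_domainD(3)[OF assms(2) that]
    by (simp only: normal_deriv_lincomb[OF C2] frontier_reflect_iff)
  ultimately show ?thesis
    using C2_holder_lincomb[OF open_domain C2] unfolding problem_P_domain_iff by blast
qed

lemma zero_in_problem_P_domain: "(\<lambda>_. 0) \<in> problem_P_domain k \<alpha> \<Omega>"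
  by (simp add: problem_P_domain_iff zero_in_C2_holder normal_deriv_def)

text \<open>The first boundary condition is that the even part vanishes on the boundary, the second that
  the odd part has vanishing normal derivative. Conversely each condition is automatic for the part
  of the other parity.\<close>

lemma even_part_dirichlet:
  assumes "u \<in> problem_P_domain k \<alpha> \<Omega>"
  shows "parity_part 1 u \<in> dirichlet_domain \<alpha> \<Omega>"
proof -
  have "parity_part 1 u x = 0" if "x \<in> frontier \<Omega>" for x
    unfolding parity_part_apply problem_P_domainD(2)[OF assms that] by simp
  with parity_part_C2_holder[OF problem_P_domainD(1)[OF assms]] show ?thesis
    by (simp add: dirichlet_domain_def)
qed

lemma odd_part_neumann:
  assumes "u \<in> problem_P_domain k \<alpha> \<Omega>"
  shows "parity_part (- 1) u \<in> neumann_domain \<alpha> \<Omega>"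
proof -
  note C2 = problem_P_domainD(1)[OF assms]
  have "normal_deriv \<Omega> (parity_part (- 1) u) x = 0" if "x \<in> frontier \<Omega>" for x
    unfolding normal_deriv_parity_part[OF C2 that] parity_part_apply
      problem_P_domainD(3)[OF assms that] by simp
  with parity_part_C2_holder[OF C2] show ?thesis by (simp add: neumann_domain_def)
qed

lemma even_part_of_dirichlet:
  assumes "v \<in> dirichlet_domain \<alpha> \<Omega>"
  shows "parity_part 1 v \<in> problem_P_domain k \<alpha> \<Omega>"
proof -
  have C2: "v \<in> C2_holder \<alpha> \<Omega>" and zero: "\<And>x. x \<in> frontier \<Omega> \<Longrightarrow> v x = 0"
    using assms by (simp_all add: dirichlet_domain_def)
  show ?thesis
    unfolding problem_P_domain_iff
  proof (intro conjI ballI)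
    fix x assume x: "x \<in> frontier \<Omega>"
    show "parity_part 1 v x = - parity_part 1 v (- x)"
      using zero[of x] zero[of "- x"] x by (simp add: parity_part_apply)
    show "normal_deriv \<Omega> (parity_part 1 v) x = normal_deriv \<Omega> (parity_part 1 v) (- x)"
      using x by (simp add: normal_deriv_parity_part[OF C2] parity_part_apply)
  qed (rule parity_part_C2_holder[OF C2])
qed

lemma odd_part_of_neumann:
  assumes "w \<in> neumann_domain \<alpha> \<Omega>"
  shows "parity_part (- 1) w \<in> problem_P_domain k \<alpha> \<Omega>"
proof -
  have C2: "w \<in> C2_holder \<alpha> \<Omega>" and zero: "\<And>x. x \<in> frontier \<Omega> \<Longrightarrow> normal_deriv \<Omega> w x = 0"
    using assms by (simp_all add: neumann_domain_def)
  show ?thesis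
    unfolding problem_P_domain_iff
  proof (intro conjI ballI)
    fix x assume x: "x \<in> frontier \<Omega>"
    show "parity_part (- 1) w x = - parity_part (- 1) w (- x)"
      by (simp add: parity_part_apply)
    show "normal_deriv \<Omega> (parity_part (- 1) w) x = normal_deriv \<Omega> (parity_part (- 1) w) (- x)"
      using x zero[of x] zero[of "- x"]
      by (simp add: normal_deriv_parity_part[OF C2] parity_part_apply)
  qed (rule parity_part_C2_holder[OF C2])
qed

end

section \<open>Classical eigenspaces\<close>

text \<open>The module structure underlying \<^const>\<open>cspan\<close>.\<close>

interpretation function_module: module "\<lambda>(c::complex) (f::'a \<Rightarrow> complex) x. c * f x"
  by unfold_locales (auto simp: fun_eq_iff algebra_simps)

lemma cspan_superset: "S \<subseteq> cspan S"
  unfolding cspan_def by (rule function_module.span_superset)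

lemma cspan_zero: "(\<lambda>_. 0) \<in> cspan S"
  using function_module.span_zero[of S] by (simp add: cspan_def zero_fun_def)

lemma cspan_add: "u \<in> cspan S \<Longrightarrow> v \<in> cspan S \<Longrightarrow> (\<lambda>x. u x + v x) \<in> cspan S"
  using function_module.span_add[of u S v] by (simp add: cspan_def plus_fun_def)

lemma cspan_minimal:
  assumes "S \<subseteq> E" "(\<lambda>_. 0) \<in> E"
    and "\<And>a b u v. u \<in> E \<Longrightarrow> v \<in> E \<Longrightarrow> (\<lambda>x. a * u x + b * v x) \<in> E"
  shows "cspan S \<subseteq> E"
  unfolding cspan_def
proof (rule function_module.span_minimal[OF assms(1)])
  show "function_module.subspace E"
  proof (rule function_module.subspaceI)
    show "0 \<in> E" using assms(2) by (simp add: zero_fun_def)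
    show "u + v \<in> E" if "u \<in> E" "v \<in> E" for u v
      using assms(3)[OF that, of 1 1] by (simp add: plus_fun_def)
    show "(\<lambda>x. c * u x) \<in> E" if "u \<in> E" for c u
      using assms(3)[OF that that, of c 0] by simp
  qed
qed

lemma eigenspaceD:
  assumes "u \<in> eigenspace \<Omega> D lam"
  shows "u \<in> D" "x \<in> \<Omega> \<Longrightarrow> laplacian u x = - (lam * u x)"
proof -
  show "u \<in> D" using assms by (simp add: eigenspace_def)
  assume "x \<in> \<Omega>"
  then have "- laplacian u x = lam * u x" using assms by (simp add: eigenspace_def)
  then show "laplacian u x = - (lam * u x)" by (metis minus_minus)
qed

context symmetric_smooth_domain
begin

text \<open>The representation by 0 outside the closure makes such a function vanish on the whole
  space.\<close>

lemma C2_holder_vanishing: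
  assumes u: "u \<in> C2_holder \<alpha> \<Omega>" and zero: "\<And>x. x \<in> \<Omega> \<Longrightarrow> u x = 0"
  shows "u = (\<lambda>_. 0)"
proof
  fix x show "u x = 0"
  proof (cases "x \<in> closure \<Omega>")
    case True
    have "continuous_on (closure \<Omega>) u" using u by (simp add: C2_holder_def)
    then show ?thesis using continuous_constant_on_closure[of \<Omega> u 0] zero True by blast
  next
    case False
    then show ?thesis using u by (simp add: C2_holder_def)
  qed
qed

lemma C2_holder_parity_extends:
  assumes u: "u \<in> C2_holder \<alpha> \<Omega>" and parity: "\<And>x. x \<in> \<Omega> \<Longrightarrow> u x = s * u (- x)"
  shows "parity_part s u = u"
proof -
  have "(\<lambda>x. 1 * parity_part s u x + (- 1) * u x) = (\<lambda>_. 0)"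
    using C2_holder_lincomb[OF open_domain parity_part_C2_holder[OF u] u]
    by (rule C2_holder_vanishing) (simp add: parity_part_eqI[where u = u, OF parity])
  then show ?thesis by (simp add: fun_eq_iff)
qed

lemma eigenspace_lincomb:
  assumes "u \<in> eigenspace \<Omega> (problem_P_domain k \<alpha> \<Omega>) lam"
    and "v \<in> eigenspace \<Omega> (problem_P_domain k \<alpha> \<Omega>) lam"
  shows "(\<lambda>x. a * u x + b * v x) \<in> eigenspace \<Omega> (problem_P_domain k \<alpha> \<Omega>) lam"
proof -
  have uv: "u \<in> problem_P_domain k \<alpha> \<Omega>" "v \<in> problem_P_domain k \<alpha> \<Omega>"
      "\<And>x. x \<in> \<Omega> \<Longrightarrow> laplacian u x = - (lam * u x)"
      "\<And>x. x \<in> \<Omega> \<Longrightarrow> laplacian v x = - (lam * v x)"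
    using eigenspaceD[OF assms(1)] eigenspaceD[OF assms(2)] by blast+
  then have C2: "Ck_on 2 \<Omega> u" "Ck_on 2 \<Omega> v"
    using problem_P_domainD(1) by (auto simp: C2_holder_def)
  have "- laplacian (\<lambda>x. a * u x + b * v x) x = lam * (a * u x + b * v x)" if "x \<in> \<Omega>" for x
    unfolding laplacian_lincomb[OF open_domain C2 that] uv(3,4)[OF that]
    by (simp add: algebra_simps)
  then show ?thesis
    using problem_P_domain_lincomb[OF uv(1,2)] by (simp add: eigenspace_def)
qed

lemma zero_in_eigenspace: "(\<lambda>_. 0) \<in> eigenspace \<Omega> (problem_P_domain k \<alpha> \<Omega>) lam"
  by (simp add: eigenspace_def zero_in_problem_P_domain laplacian_def partial_deriv_zero)

lemma parity_part_eigenspace: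
  assumes u: "u \<in> eigenspace \<Omega> D lam" and D: "D \<subseteq> C2_holder \<alpha> \<Omega>" and D': "parity_part s u \<in> D'"
  shows "parity_part s u \<in> eigenspace \<Omega> D' lam"
proof -
  have C2: "u \<in> C2_holder \<alpha> \<Omega>" and eq: "\<And>x. x \<in> \<Omega> \<Longrightarrow> laplacian u x = - (lam * u x)"
    using eigenspaceD[OF u] D by blast+
  have "- laplacian (parity_part s u) x = lam * parity_part s u x" if "x \<in> \<Omega>" for x
    using eq[of x] eq[of "- x"] that
    by (simp add: laplacian_parity_part[OF C2 that] parity_part_apply algebra_simps)
  with D' show ?thesis by (simp add: eigenspace_def)
qed

lemma dirichlet_domain_C2: "dirichlet_domain \<alpha> \<Omega> \<subseteq> C2_holder \<alpha> \<Omega>"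
  and neumann_domain_C2: "neumann_domain \<alpha> \<Omega> \<subseteq> C2_holder \<alpha> \<Omega>"
  and problem_P_domain_C2: "problem_P_domain k \<alpha> \<Omega> \<subseteq> C2_holder \<alpha> \<Omega>"
  by (auto simp: dirichlet_domain_def neumann_domain_def problem_P_domain_def)

lemma first_series_subset:
  "first_series \<alpha> \<Omega> lam \<subseteq> eigenfunctions \<Omega> (problem_P_domain k \<alpha> \<Omega>) lam"
proof
  fix v assume "v \<in> first_series \<alpha> \<Omega> lam"
  then have v: "v \<in> eigenspace \<Omega> (dirichlet_domain \<alpha> \<Omega>) lam" "\<exists>x\<in>\<Omega>. v x \<noteq> 0"
      and sym: "\<And>x. x \<in> \<Omega> \<Longrightarrow> v x - v (- x) = 0"
    unfolding first_series_def eigenfunctions_def by blast+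
  have parity: "v x = 1 * v (- x)" if "x \<in> \<Omega>" for x
    using sym[OF that] by simp
  from v(1) have dom: "v \<in> dirichlet_domain \<alpha> \<Omega>" by (simp add: eigenspace_def)
  then have eq: "parity_part 1 v = v"
    using dirichlet_domain_C2 parity by (intro C2_holder_parity_extends[of v \<alpha>]) blast+
  have "v \<in> eigenspace \<Omega> (problem_P_domain k \<alpha> \<Omega>) lam"
    using parity_part_eigenspace[OF v(1) dirichlet_domain_C2 even_part_of_dirichlet[OF dom]]
    unfolding eq .
  with v(2) show "v \<in> eigenfunctions \<Omega> (problem_P_domain k \<alpha> \<Omega>) lam"
    by (simp add: eigenfunctions_def)
qed

lemma second_series_subset:
  "second_series \<alpha> \<Omega> lam \<subseteq> eigenfunctions \<Omega> (problem_P_domain k \<alpha> \<Omega>) lam"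
proof
  fix w assume "w \<in> second_series \<alpha> \<Omega> lam"
  then have w: "w \<in> eigenspace \<Omega> (neumann_domain \<alpha> \<Omega>) lam" "\<exists>x\<in>\<Omega>. w x \<noteq> 0"
      and sym: "\<And>x. x \<in> \<Omega> \<Longrightarrow> w x + w (- x) = 0"
    unfolding second_series_def eigenfunctions_def by blast+
  have parity: "w x = (- 1) * w (- x)" if "x \<in> \<Omega>" for x
    using sym[OF that] by (simp add: eq_neg_iff_add_eq_0)
  from w(1) have dom: "w \<in> neumann_domain \<alpha> \<Omega>" by (simp add: eigenspace_def)
  then have eq: "parity_part (- 1) w = w"
    using neumann_domain_C2 parity by (intro C2_holder_parity_extends[of w \<alpha>]) blast+
  have "w \<in> eigenspace \<Omega> (problem_P_domain k \<alpha> \<Omega>) lam"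
    using parity_part_eigenspace[OF w(1) neumann_domain_C2 odd_part_of_neumann[OF dom]]
    unfolding eq .
  with w(2) show "w \<in> eigenfunctions \<Omega> (problem_P_domain k \<alpha> \<Omega>) lam"
    by (simp add: eigenfunctions_def)
qed

text \<open>The zero function is no eigenfunction, so it appears as a separate case.\<close>

lemma even_part_series:
  assumes "u \<in> eigenspace \<Omega> (problem_P_domain k \<alpha> \<Omega>) lam"
  shows "parity_part 1 u = (\<lambda>_. 0) \<or> parity_part 1 u \<in> first_series \<alpha> \<Omega> lam"
proof -
  have dom: "u \<in> problem_P_domain k \<alpha> \<Omega>" using assms by (simp add: eigenspace_def)
  then have "parity_part 1 u \<in> eigenspace \<Omega> (dirichlet_domain \<alpha> \<Omega>) lam"
    by (intro parity_part_eigenspace[OF assms problem_P_domain_C2] even_part_dirichlet)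
  moreover have "parity_part 1 u x - parity_part 1 u (- x) = 0" for x
    by (simp add: parity_part_apply)
  ultimately show ?thesis
    using C2_holder_vanishing[OF parity_part_C2_holder[OF problem_P_domainD(1)[OF dom]], of 1]
    unfolding first_series_def eigenfunctions_def by blast
qed

lemma odd_part_series:
  assumes "u \<in> eigenspace \<Omega> (problem_P_domain k \<alpha> \<Omega>) lam"
  shows "parity_part (- 1) u = (\<lambda>_. 0) \<or> parity_part (- 1) u \<in> second_series \<alpha> \<Omega> lam"
proof -
  have dom: "u \<in> problem_P_domain k \<alpha> \<Omega>" using assms by (simp add: eigenspace_def)
  then have "parity_part (- 1) u \<in> eigenspace \<Omega> (neumann_domain \<alpha> \<Omega>) lam"
    by (intro parity_part_eigenspace[OF assms problem_P_domain_C2] odd_part_neumann)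
  moreover have "parity_part (- 1) u x + parity_part (- 1) u (- x) = 0" for x
    by (simp add: parity_part_apply)
  ultimately show ?thesis
    using C2_holder_vanishing[OF parity_part_C2_holder[OF problem_P_domainD(1)[OF dom]], of "- 1"]
    unfolding second_series_def eigenfunctions_def by blast
qed

theorem classical_eigenspace:
  "eigenspace \<Omega> (problem_P_domain k \<alpha> \<Omega>) lam
     = cspan (first_series \<alpha> \<Omega> lam \<union> second_series \<alpha> \<Omega> lam)" (is "?E = cspan ?S")
proof
  show "cspan ?S \<subseteq> ?E"
  proof (rule cspan_minimal)
    show "?S \<subseteq> ?E"
      using first_series_subset second_series_subset unfolding eigenfunctions_def by blast
  qed (rule zero_in_eigenspace, rule eigenspace_lincomb)
  show "?E \<subseteq> cspan ?S"
  proof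
    fix u assume u: "u \<in> ?E"
    have "parity_part 1 u \<in> cspan ?S" "parity_part (- 1) u \<in> cspan ?S"
      using even_part_series[OF u] odd_part_series[OF u] cspan_zero cspan_superset[of ?S] by auto
    then have "(\<lambda>x. parity_part 1 u x + parity_part (- 1) u x) \<in> cspan ?S" by (rule cspan_add)
    then show "u \<in> cspan ?S" by (simp add: even_part_plus_odd_part)
  qed
qed

theorem classical_eigenvalues:
  "eigenfunctions \<Omega> (problem_P_domain k \<alpha> \<Omega>) lam \<noteq> {} \<longleftrightarrow>
     first_series \<alpha> \<Omega> lam \<noteq> {} \<or> second_series \<alpha> \<Omega> lam \<noteq> {}"
proof
  assume "eigenfunctions \<Omega> (problem_P_domain k \<alpha> \<Omega>) lam \<noteq> {}"
  then obtain u x where u: "u \<in> eigenspace \<Omega> (problem_P_domain k \<alpha> \<Omega>) lam" and "u x \<noteq> 0"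
    by (auto simp: eigenfunctions_def)
  then have "\<not> (parity_part 1 u = (\<lambda>_. 0) \<and> parity_part (- 1) u = (\<lambda>_. 0))"
    using even_part_plus_odd_part[of u x] by auto
  then show "first_series \<alpha> \<Omega> lam \<noteq> {} \<or> second_series \<alpha> \<Omega> lam \<noteq> {}"
    using even_part_series[OF u] odd_part_series[OF u] by blast
next
  assume "first_series \<alpha> \<Omega> lam \<noteq> {} \<or> second_series \<alpha> \<Omega> lam \<noteq> {}"
  then show "eigenfunctions \<Omega> (problem_P_domain k \<alpha> \<Omega>) lam \<noteq> {}"
    using first_series_subset second_series_subset by fastforce
qed

end

section \<open>Square integrable functions\<close>

text \<open>The squared \<open>L2\<close> norm, with values in the extended nonnegative reals so that it makes sense
  without integrability.\<close>

definition L2_sq :: "(real^'n::finite) set \<Rightarrow> (real^'n \<Rightarrow> complex) \<Rightarrow> ennreal" where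
  "L2_sq \<Omega> f = (\<integral>\<^sup>+x. ennreal ((norm (f x))\<^sup>2) \<partial>lebesgue_on \<Omega>)"

lemma L2_tendsto_iff: "L2_tendsto \<Omega> U u \<longleftrightarrow> (\<lambda>m. L2_sq \<Omega> (\<lambda>x. U m x - u x)) \<longlonglongrightarrow> 0"
  by (simp add: L2_tendsto_def L2_sq_def)

lemma L2_on_iff: "u \<in> L2_on \<Omega> \<longleftrightarrow> u \<in> borel_measurable (lebesgue_on \<Omega>) \<and> L2_sq \<Omega> u < \<infinity>"
  by (auto simp: L2_on_def L2_sq_def integrable_iff_bounded)

lemma L2_sq_cong_AE:
  "AE x in lebesgue_on \<Omega>. f x = g x \<Longrightarrow> L2_sq \<Omega> f = L2_sq \<Omega> g"
  unfolding L2_sq_def by (rule nn_integral_cong_AE) auto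

lemma norm_lincomb_sq_le:
  fixes a b x y :: complex
  shows "(norm (a * x + b * y))\<^sup>2 \<le> 2 * (norm a)\<^sup>2 * (norm x)\<^sup>2 + 2 * (norm b)\<^sup>2 * (norm y)\<^sup>2"
proof -
  have "(norm (a * x + b * y))\<^sup>2 \<le> (norm (a * x) + norm (b * y))\<^sup>2"
    by (intro power_mono norm_triangle_ineq norm_ge_zero)
  also have "\<dots> \<le> 2 * (norm (a * x))\<^sup>2 + 2 * (norm (b * y))\<^sup>2"
    using sum_squares_bound[of "norm (a * x)" "norm (b * y)"] by (simp add: power2_sum)
  finally show ?thesis by (simp add: norm_mult power_mult_distrib)
qed

lemma L2_sq_lincomb_le:
  assumes [measurable]: "f \<in> borel_measurable (lebesgue_on \<Omega>)" "g \<in> borel_measurable (lebesgue_on \<Omega>)"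
  shows "L2_sq \<Omega> (\<lambda>x. a * f x + b * g x)
    \<le> ennreal (2 * (norm a)\<^sup>2) * L2_sq \<Omega> f + ennreal (2 * (norm b)\<^sup>2) * L2_sq \<Omega> g"
proof -
  have "L2_sq \<Omega> (\<lambda>x. a * f x + b * g x)
      \<le> (\<integral>\<^sup>+x. ennreal (2 * (norm a)\<^sup>2) * ennreal ((norm (f x))\<^sup>2)
            + ennreal (2 * (norm b)\<^sup>2) * ennreal ((norm (g x))\<^sup>2) \<partial>lebesgue_on \<Omega>)"
    unfolding L2_sq_def
    by (intro nn_integral_mono)
       (simp add: norm_lincomb_sq_le flip: ennreal_mult' ennreal_plus)
  also have "\<dots> = ennreal (2 * (norm a)\<^sup>2) * L2_sq \<Omega> f + ennreal (2 * (norm b)\<^sup>2) * L2_sq \<Omega> g"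
    by (simp add: L2_sq_def nn_integral_add nn_integral_cmult)
  finally show ?thesis .
qed

lemma L2_on_lincomb:
  assumes "u \<in> L2_on \<Omega>" "v \<in> L2_on \<Omega>"
  shows "(\<lambda>x. a * u x + b * v x) \<in> L2_on \<Omega>"
proof -
  have [measurable]: "u \<in> borel_measurable (lebesgue_on \<Omega>)" "v \<in> borel_measurable (lebesgue_on \<Omega>)"
    and fin: "L2_sq \<Omega> u < \<infinity>" "L2_sq \<Omega> v < \<infinity>"
    using assms by (simp_all add: L2_on_iff)
  have "L2_sq \<Omega> (\<lambda>x. a * u x + b * v x)
      \<le> ennreal (2 * (norm a)\<^sup>2) * L2_sq \<Omega> u + ennreal (2 * (norm b)\<^sup>2) * L2_sq \<Omega> v"
    by (rule L2_sq_lincomb_le) measurable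
  also have "\<dots> < \<infinity>" using fin by (simp add: ennreal_mult_less_top)
  finally show ?thesis by (simp add: L2_on_iff)
qed

lemma L2_tendsto_lincomb:
  assumes "\<And>m. U m \<in> borel_measurable (lebesgue_on \<Omega>)" "\<And>m. V m \<in> borel_measurable (lebesgue_on \<Omega>)"
    and "u \<in> borel_measurable (lebesgue_on \<Omega>)" "v \<in> borel_measurable (lebesgue_on \<Omega>)"
    and "L2_tendsto \<Omega> U u" "L2_tendsto \<Omega> V v"
  shows "L2_tendsto \<Omega> (\<lambda>m x. a * U m x + b * V m x) (\<lambda>x. a * u x + b * v x)"
  unfolding L2_tendsto_iff
proof (rule tendsto_sandwich[OF _ _ tendsto_const])
  let ?B = "\<lambda>m. ennreal (2 * (norm a)\<^sup>2) * L2_sq \<Omega> (\<lambda>x. U m x - u x)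
        + ennreal (2 * (norm b)\<^sup>2) * L2_sq \<Omega> (\<lambda>x. V m x - v x)"
  have "?B \<longlonglongrightarrow> ennreal (2 * (norm a)\<^sup>2) * 0 + ennreal (2 * (norm b)\<^sup>2) * 0"
    using assms(5,6) by (intro tendsto_add ennreal_tendsto_cmult) (simp_all add: L2_tendsto_iff)
  then show "?B \<longlonglongrightarrow> 0" by simp
  have "L2_sq \<Omega> (\<lambda>x. a * U m x + b * V m x - (a * u x + b * v x)) \<le> ?B m" for m
  proof -
    have "(\<lambda>x. a * U m x + b * V m x - (a * u x + b * v x))
        = (\<lambda>x. a * (U m x - u x) + b * (V m x - v x))" by (simp add: algebra_simps)
    then show ?thesis
      using L2_sq_lincomb_le[OF borel_measurable_diff[OF assms(1)[of m] assms(3)]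
          borel_measurable_diff[OF assms(2)[of m] assms(4)]] by simp
  qed
  then show "\<forall>\<^sub>F m in sequentially. L2_sq \<Omega> (\<lambda>x. a * U m x + b * V m x - (a * u x + b * v x)) \<le> ?B m"
    by simp
qed simp

lemma L2_tendsto_cong:
  assumes "\<And>m. AE x in lebesgue_on \<Omega>. U m x = V m x" "AE x in lebesgue_on \<Omega>. u x = v x"
    and "L2_tendsto \<Omega> U u"
  shows "L2_tendsto \<Omega> V v"
proof -
  have "L2_sq \<Omega> (\<lambda>x. U m x - u x) = L2_sq \<Omega> (\<lambda>x. V m x - v x)" for m
    by (rule L2_sq_cong_AE) (use assms(1)[of m] assms(2) in eventually_elim, simp)
  with assms(3) show ?thesis by (simp add: L2_tendsto_iff)
qed

lemma
  shows lebesgue_measurable_uminus: "(uminus :: 'a::euclidean_space \<Rightarrow> 'a) \<in> lebesgue \<rightarrow>\<^sub>M lebesgue"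
    and lebesgue_distr_uminus: "distr lebesgue lebesgue (uminus :: 'a \<Rightarrow> 'a) = lebesgue"
proof -
  have eq: "(\<lambda>x::'a. 0 + (\<Sum>j\<in>Basis. (- 1 * (x \<bullet> j)) *\<^sub>R j)) = uminus"
    by (simp add: fun_eq_iff sum_negf euclidean_representation)
  show "(uminus :: 'a \<Rightarrow> 'a) \<in> lebesgue \<rightarrow>\<^sub>M lebesgue"
    using lebesgue_affine_measurable[of "\<lambda>_. - 1" "0::'a"] unfolding eq by simp
  show "distr lebesgue lebesgue (uminus :: 'a \<Rightarrow> 'a) = lebesgue"
    using lebesgue_affine_euclidean[of "\<lambda>_. - 1" "0::'a"] unfolding eq by (simp add: density_1)
qed

context symmetric_smooth_domain
begin

lemma domain_lebesgue: "\<Omega> \<in> sets lebesgue"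
  using open_domain by (simp add: borel_open)

lemma measurable_reflect:
  assumes "f \<in> borel_measurable (lebesgue_on \<Omega>)"
  shows "(\<lambda>x. f (- x)) \<in> borel_measurable (lebesgue_on \<Omega>)"
proof -
  have "uminus \<in> lebesgue_on \<Omega> \<rightarrow>\<^sub>M lebesgue_on \<Omega>"
    by (intro measurable_restrict_space3 lebesgue_measurable_uminus) auto
  from measurable_compose[OF this assms] show ?thesis .
qed

lemma L2_sq_reflect:
  assumes "f \<in> borel_measurable (lebesgue_on \<Omega>)"
  shows "L2_sq \<Omega> (\<lambda>x. f (- x)) = L2_sq \<Omega> f"
proof -
  let ?h = "\<lambda>x. ennreal ((norm (f x))\<^sup>2) * indicator \<Omega> x"
  have "(\<lambda>x. ennreal ((norm (f x))\<^sup>2)) \<in> borel_measurable (lebesgue_on \<Omega>)"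
    using assms by measurable
  then have h: "?h \<in> borel_measurable lebesgue"
    using domain_lebesgue by (subst (asm) borel_measurable_restrict_space_iff_ennreal) auto
  have "L2_sq \<Omega> (\<lambda>x. f (- x)) = (\<integral>\<^sup>+x. ?h (- x) \<partial>lebesgue)"
    using domain_lebesgue
    by (simp add: L2_sq_def nn_integral_restrict_space indicator_def)
  also have "\<dots> = (\<integral>\<^sup>+x. ?h x \<partial>distr lebesgue lebesgue uminus)"
    by (rule nn_integral_distr[symmetric]) (simp_all add: lebesgue_measurable_uminus h)
  also have "\<dots> = L2_sq \<Omega> f"
    using domain_lebesgue
    by (simp add: lebesgue_distr_uminus L2_sq_def nn_integral_restrict_space)
  finally show ?thesis .
qed

lemma L2_on_parity_part:
  assumes "u \<in> L2_on \<Omega>"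
  shows "parity_part s u \<in> L2_on \<Omega>"
  unfolding parity_part_def using assms
  by (intro L2_on_lincomb) (simp_all add: L2_on_iff measurable_reflect L2_sq_reflect)

lemma L2_tendsto_parity_part:
  assumes U: "\<And>m. U m \<in> borel_measurable (lebesgue_on \<Omega>)" and u: "u \<in> borel_measurable (lebesgue_on \<Omega>)"
    and lim: "L2_tendsto \<Omega> U u"
  shows "L2_tendsto \<Omega> (\<lambda>m. parity_part s (U m)) (parity_part s u)"
  unfolding parity_part_def
proof (rule L2_tendsto_lincomb)
  have "L2_sq \<Omega> (\<lambda>x. U m (- x) - u (- x)) = L2_sq \<Omega> (\<lambda>x. U m x - u x)" for m
    by (rule L2_sq_reflect[OF borel_measurable_diff[OF U u]])
  then show "L2_tendsto \<Omega> (\<lambda>m x. U m (- x)) (\<lambda>x. u (- x))"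
    using lim by (simp add: L2_tendsto_iff)
qed (use assms in \<open>simp_all add: measurable_reflect\<close>)

section \<open>The closed operators\<close>

lemma C2_holder_measurable:
  assumes "u \<in> C2_holder \<alpha> \<Omega>"
  shows "u \<in> borel_measurable (lebesgue_on \<Omega>)"
    and "(\<lambda>x. - laplacian u x) \<in> borel_measurable (lebesgue_on \<Omega>)"
proof -
  have C2: "Ck_on 2 \<Omega> u" using assms by (simp add: C2_holder_def)
  show "u \<in> borel_measurable (lebesgue_on \<Omega>)"
    using C2 by (intro continuous_imp_measurable_on_sets_lebesgue[OF _ domain_lebesgue]
        Ck_on_imp_continuous_on)
  show "(\<lambda>x. - laplacian u x) \<in> borel_measurable (lebesgue_on \<Omega>)"
    using C2 by (intro continuous_imp_measurable_on_sets_lebesgue[OF _ domain_lebesgue]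
        continuous_on_minus continuous_on_laplacian)
qed

lemma AE_lebesgue_onI: "(\<And>x. x \<in> \<Omega> \<Longrightarrow> P x) \<Longrightarrow> AE x in lebesgue_on \<Omega>. P x"
  by (rule AE_I2) simp

text \<open>The approximating right-hand sides are determined by the approximating functions.\<close>

lemma L2_closure_neg_laplace_graph_iff:
  "(u, f) \<in> L2_closure \<Omega> (neg_laplace_graph D) \<longleftrightarrow> u \<in> L2_on \<Omega> \<and> f \<in> L2_on \<Omega> \<and>
     (\<exists>U. (\<forall>m. U m \<in> D) \<and> L2_tendsto \<Omega> U u \<and> L2_tendsto \<Omega> (\<lambda>m x. - laplacian (U m) x) f)"
    (is "?l \<longleftrightarrow> ?r")
proof
  assume ?l
  then obtain U F where *: "u \<in> L2_on \<Omega>" "f \<in> L2_on \<Omega>" "\<forall>m. (U m, F m) \<in> neg_laplace_graph D"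
      "L2_tendsto \<Omega> U u" "L2_tendsto \<Omega> F f"
    unfolding L2_closure_def by blast
  then have "F m = (\<lambda>x. - laplacian (U m) x)" "U m \<in> D" for m
    unfolding neg_laplace_graph_def by blast+
  then have "F = (\<lambda>m x. - laplacian (U m) x)" "\<forall>m. U m \<in> D" by blast+
  with * show ?r by blast
next
  assume ?r
  then obtain U where "u \<in> L2_on \<Omega>" "f \<in> L2_on \<Omega>" "\<forall>m. U m \<in> D"
      "L2_tendsto \<Omega> U u" "L2_tendsto \<Omega> (\<lambda>m x. - laplacian (U m) x) f"
    by blast
  moreover from this(3) have "\<forall>m. (U m, \<lambda>x. - laplacian (U m) x) \<in> neg_laplace_graph D"
    unfolding neg_laplace_graph_def by blast
  ultimately show ?l unfolding L2_closure_def mem_Collect_eq case_prod_conv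
    by (intro conjI exI[of _ U] exI[of _ "\<lambda>m x. - laplacian (U m) x"]) assumption+
qed

lemma L2_closure_lincomb:
  assumes D: "D \<subseteq> C2_holder \<alpha> \<Omega>"
    and lin: "\<And>u v. u \<in> D \<Longrightarrow> v \<in> D \<Longrightarrow> (\<lambda>x. a * u x + b * v x) \<in> D"
    and uf: "(u, f) \<in> L2_closure \<Omega> (neg_laplace_graph D)"
    and vg: "(v, g) \<in> L2_closure \<Omega> (neg_laplace_graph D)"
  shows "(\<lambda>x. a * u x + b * v x, \<lambda>x. a * f x + b * g x) \<in> L2_closure \<Omega> (neg_laplace_graph D)"
proof -
  obtain U where U: "\<And>m. U m \<in> D" "L2_tendsto \<Omega> U u" "L2_tendsto \<Omega> (\<lambda>m x. - laplacian (U m) x) f"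
    using uf unfolding L2_closure_neg_laplace_graph_iff by blast
  obtain V where V: "\<And>m. V m \<in> D" "L2_tendsto \<Omega> V v" "L2_tendsto \<Omega> (\<lambda>m x. - laplacian (V m) x) g"
    using vg unfolding L2_closure_neg_laplace_graph_iff by blast
  have UC: "U m \<in> C2_holder \<alpha> \<Omega>" and VC: "V m \<in> C2_holder \<alpha> \<Omega>" for m
    using U(1) V(1) D by blast+
  have L2: "u \<in> L2_on \<Omega>" "f \<in> L2_on \<Omega>" "v \<in> L2_on \<Omega>" "g \<in> L2_on \<Omega>"
    using uf vg unfolding L2_closure_neg_laplace_graph_iff by blast+
  then have meas: "u \<in> borel_measurable (lebesgue_on \<Omega>)" "f \<in> borel_measurable (lebesgue_on \<Omega>)"
      "v \<in> borel_measurable (lebesgue_on \<Omega>)" "g \<in> borel_measurable (lebesgue_on \<Omega>)"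
    by (simp_all add: L2_on_iff)
  let ?W = "\<lambda>m x. a * U m x + b * V m x"
  have lap: "a * (- laplacian (U m) x) + b * (- laplacian (V m) x) = - laplacian (?W m) x"
    if "x \<in> \<Omega>" for m x
    using laplacian_lincomb[OF open_domain _ _ that, of "U m" "V m" a b] UC[of m] VC[of m]
    by (simp add: C2_holder_def)
  have "L2_tendsto \<Omega> ?W (\<lambda>x. a * u x + b * v x)"
    by (rule L2_tendsto_lincomb[OF C2_holder_measurable(1)[OF UC] C2_holder_measurable(1)[OF VC]
          meas(1,3) U(2) V(2)])
  moreover have "L2_tendsto \<Omega> (\<lambda>m x. - laplacian (?W m) x) (\<lambda>x. a * f x + b * g x)"
    by (rule L2_tendsto_cong[OF AE_lebesgue_onI[OF lap] AE_lebesgue_onI[OF refl]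
          L2_tendsto_lincomb[OF C2_holder_measurable(2)[OF UC] C2_holder_measurable(2)[OF VC]
            meas(2,4) U(3) V(3)]])
  moreover have "\<forall>m. ?W m \<in> D" using lin U(1) V(1) by blast
  ultimately show ?thesis
    unfolding L2_closure_neg_laplace_graph_iff
    using L2_on_lincomb[OF L2(1,3)] L2_on_lincomb[OF L2(2,4)]
    by (intro conjI exI[of _ ?W]) assumption+
qed

text \<open>Taking parts of a given parity commutes with the Laplacian and is continuous in \<open>L2\<close>, so
  a map between two domains of the Laplacian extends to the closures of the graphs.\<close>

lemma L2_closure_parity_part:
  assumes D: "D \<subseteq> C2_holder \<alpha> \<Omega>"
    and D': "\<And>u. u \<in> D \<Longrightarrow> parity_part s u \<in> D'"
    and uf: "(u, f) \<in> L2_closure \<Omega> (neg_laplace_graph D)"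
  shows "(parity_part s u, parity_part s f) \<in> L2_closure \<Omega> (neg_laplace_graph D')"
proof -
  obtain U where U: "\<And>m. U m \<in> D" "L2_tendsto \<Omega> U u" "L2_tendsto \<Omega> (\<lambda>m x. - laplacian (U m) x) f"
    using uf unfolding L2_closure_neg_laplace_graph_iff by blast
  have UC: "U m \<in> C2_holder \<alpha> \<Omega>" for m using U(1) D by blast
  have L2: "u \<in> L2_on \<Omega>" "f \<in> L2_on \<Omega>"
    using uf unfolding L2_closure_neg_laplace_graph_iff by blast+
  then have meas: "u \<in> borel_measurable (lebesgue_on \<Omega>)" "f \<in> borel_measurable (lebesgue_on \<Omega>)"
    by (simp_all add: L2_on_iff)
  have lap: "parity_part s (\<lambda>x. - laplacian (U m) x) x = - laplacian (parity_part s (U m)) x"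
    if "x \<in> \<Omega>" for m x
    by (simp add: laplacian_parity_part[OF UC that] parity_part_apply)
  have "L2_tendsto \<Omega> (\<lambda>m. parity_part s (U m)) (parity_part s u)"
    by (rule L2_tendsto_parity_part[OF C2_holder_measurable(1)[OF UC] meas(1) U(2)])
  moreover have "L2_tendsto \<Omega> (\<lambda>m x. - laplacian (parity_part s (U m)) x) (parity_part s f)"
    by (rule L2_tendsto_cong[OF AE_lebesgue_onI[OF lap] AE_lebesgue_onI[OF refl]
          L2_tendsto_parity_part[OF C2_holder_measurable(2)[OF UC] meas(2) U(3)]])
  ultimately show ?thesis
    unfolding L2_closure_neg_laplace_graph_iff
    using L2_on_parity_part[OF L2(1)] L2_on_parity_part[OF L2(2)] D'[OF U(1)]
    by (intro conjI allI exI[of _ "\<lambda>m. parity_part s (U m)"]) assumption+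
qed

lemma L2_eigenspace_cong_AE:
  assumes "u \<in> L2_eigenspace \<Omega> D lam" "AE x in lebesgue_on \<Omega>. u x = v x" "v \<in> L2_on \<Omega>"
  shows "v \<in> L2_eigenspace \<Omega> D lam"
proof -
  obtain U where U: "\<forall>m. U m \<in> D" "L2_tendsto \<Omega> U u"
      "L2_tendsto \<Omega> (\<lambda>m x. - laplacian (U m) x) (\<lambda>x. lam * u x)"
    using assms(1) unfolding L2_eigenspace_def L2_closure_neg_laplace_graph_iff by blast
  have AE: "AE x in lebesgue_on \<Omega>. lam * u x = lam * v x"
    using assms(2) by eventually_elim simp
  have "L2_tendsto \<Omega> U v" "L2_tendsto \<Omega> (\<lambda>m x. - laplacian (U m) x) (\<lambda>x. lam * v x)"
    using L2_tendsto_cong[OF AE_lebesgue_onI[OF refl] assms(2) U(2)]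
      L2_tendsto_cong[OF AE_lebesgue_onI[OF refl] AE U(3)] by blast+
  moreover have "(\<lambda>x. lam * v x) \<in> L2_on \<Omega>"
    using L2_on_lincomb[OF assms(3,3), of lam 0] by simp
  ultimately show ?thesis
    using U(1) assms(3) unfolding L2_eigenspace_def L2_closure_neg_laplace_graph_iff by blast
qed

lemma L2_eigenspace_L2_on: "u \<in> L2_eigenspace \<Omega> D lam \<Longrightarrow> u \<in> L2_on \<Omega>"
  by (simp add: L2_eigenspace_def L2_closure_def)

lemma L2_eigenspace_parity_part:
  assumes "D \<subseteq> C2_holder \<alpha> \<Omega>" "\<And>u. u \<in> D \<Longrightarrow> parity_part s u \<in> D'" "u \<in> L2_eigenspace \<Omega> D lam"
  shows "parity_part s u \<in> L2_eigenspace \<Omega> D' lam"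
proof -
  have "parity_part s (\<lambda>x. lam * u x) = (\<lambda>x. lam * parity_part s u x)"
    by (simp add: parity_part_apply fun_eq_iff algebra_simps)
  with L2_closure_parity_part[OF assms(1,2)] assms(3) show ?thesis
    unfolding L2_eigenspace_def by fastforce
qed

lemma L2_eigenspace_lincomb:
  assumes "u \<in> L2_eigenspace \<Omega> (problem_P_domain k \<alpha> \<Omega>) lam"
    and "v \<in> L2_eigenspace \<Omega> (problem_P_domain k \<alpha> \<Omega>) lam"
  shows "(\<lambda>x. a * u x + b * v x) \<in> L2_eigenspace \<Omega> (problem_P_domain k \<alpha> \<Omega>) lam"
proof -
  have "(\<lambda>x. a * u x + b * v x, \<lambda>x. a * (lam * u x) + b * (lam * v x))
      \<in> L2_closure \<Omega> (neg_laplace_graph (problem_P_domain k \<alpha> \<Omega>))"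
    using assms unfolding L2_eigenspace_def
    by (intro L2_closure_lincomb[OF problem_P_domain_C2] problem_P_domain_lincomb) auto
  then show ?thesis by (simp add: L2_eigenspace_def algebra_simps)
qed

lemma zero_in_L2_eigenspace: "(\<lambda>_. 0) \<in> L2_eigenspace \<Omega> (problem_P_domain k \<alpha> \<Omega>) lam"
proof -
  have "L2_tendsto \<Omega> (\<lambda>m. \<lambda>_. 0) (\<lambda>_. 0)" "(\<lambda>_. 0) \<in> L2_on \<Omega>"
    by (simp_all add: L2_tendsto_def L2_on_def)
  moreover have "laplacian (\<lambda>_::real^'n. 0::complex) = (\<lambda>_. 0)"
    by (simp add: laplacian_def partial_deriv_zero fun_eq_iff)
  ultimately show ?thesis
    unfolding L2_eigenspace_def mem_Collect_eq L2_closure_neg_laplace_graph_iff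
    by (intro conjI exI[of _ "\<lambda>_ _. 0"]) (simp_all add: zero_in_problem_P_domain)
qed

text \<open>A function of the first series is even only almost everywhere, and its approximating
  Dirichlet functions need not be even. Their even parts satisfy the conditions of problem P and
  still converge to it. The second series is treated in the same way.\<close>

lemma L2_first_series_subset:
  "L2_first_series \<alpha> \<Omega> lam \<subseteq> L2_eigenfunctions \<Omega> (problem_P_domain k \<alpha> \<Omega>) lam"
proof
  fix v assume "v \<in> L2_first_series \<alpha> \<Omega> lam"
  then have v: "v \<in> L2_eigenspace \<Omega> (dirichlet_domain \<alpha> \<Omega>) lam"
      "\<not> (AE x in lebesgue_on \<Omega>. v x = 0)" "AE x in lebesgue_on \<Omega>. v x - v (- x) = 0"
    unfolding L2_first_series_def L2_eigenfunctions_def by blast+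
  have "parity_part 1 v \<in> L2_eigenspace \<Omega> (problem_P_domain k \<alpha> \<Omega>) lam"
    by (rule L2_eigenspace_parity_part[OF dirichlet_domain_C2 even_part_of_dirichlet v(1)])
  moreover have "AE x in lebesgue_on \<Omega>. parity_part 1 v x = v x"
    using v(3) by eventually_elim (rule parity_part_eqI, simp)
  ultimately have "v \<in> L2_eigenspace \<Omega> (problem_P_domain k \<alpha> \<Omega>) lam"
    by (rule L2_eigenspace_cong_AE[OF _ _ L2_eigenspace_L2_on[OF v(1)]])
  with v(2) show "v \<in> L2_eigenfunctions \<Omega> (problem_P_domain k \<alpha> \<Omega>) lam"
    by (simp add: L2_eigenfunctions_def)
qed

lemma L2_second_series_subset:
  "L2_second_series \<alpha> \<Omega> lam \<subseteq> L2_eigenfunctions \<Omega> (problem_P_domain k \<alpha> \<Omega>) lam"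
proof
  fix w assume "w \<in> L2_second_series \<alpha> \<Omega> lam"
  then have w: "w \<in> L2_eigenspace \<Omega> (neumann_domain \<alpha> \<Omega>) lam"
      "\<not> (AE x in lebesgue_on \<Omega>. w x = 0)" "AE x in lebesgue_on \<Omega>. w x + w (- x) = 0"
    unfolding L2_second_series_def L2_eigenfunctions_def by blast+
  have "parity_part (- 1) w \<in> L2_eigenspace \<Omega> (problem_P_domain k \<alpha> \<Omega>) lam"
    by (rule L2_eigenspace_parity_part[OF neumann_domain_C2 odd_part_of_neumann w(1)])
  moreover have "AE x in lebesgue_on \<Omega>. parity_part (- 1) w x = w x"
    using w(3) by eventually_elim (rule parity_part_eqI, simp add: eq_neg_iff_add_eq_0)
  ultimately have "w \<in> L2_eigenspace \<Omega> (problem_P_domain k \<alpha> \<Omega>) lam"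
    by (rule L2_eigenspace_cong_AE[OF _ _ L2_eigenspace_L2_on[OF w(1)]])
  with w(2) show "w \<in> L2_eigenfunctions \<Omega> (problem_P_domain k \<alpha> \<Omega>) lam"
    by (simp add: L2_eigenfunctions_def)
qed

lemma L2_even_part_series:
  assumes "u \<in> L2_eigenspace \<Omega> (problem_P_domain k \<alpha> \<Omega>) lam"
  shows "(AE x in lebesgue_on \<Omega>. parity_part 1 u x = 0) \<or> parity_part 1 u \<in> L2_first_series \<alpha> \<Omega> lam"
proof -
  have "parity_part 1 u \<in> L2_eigenspace \<Omega> (dirichlet_domain \<alpha> \<Omega>) lam"
    by (rule L2_eigenspace_parity_part[OF problem_P_domain_C2 even_part_dirichlet assms])
  moreover have "AE x in lebesgue_on \<Omega>. parity_part 1 u x - parity_part 1 u (- x) = 0"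
    by (rule AE_lebesgue_onI) (simp add: parity_part_apply)
  ultimately show ?thesis unfolding L2_first_series_def L2_eigenfunctions_def by blast
qed

lemma L2_odd_part_series:
  assumes "u \<in> L2_eigenspace \<Omega> (problem_P_domain k \<alpha> \<Omega>) lam"
  shows "(AE x in lebesgue_on \<Omega>. parity_part (- 1) u x = 0) \<or>
    parity_part (- 1) u \<in> L2_second_series \<alpha> \<Omega> lam"
proof -
  have "parity_part (- 1) u \<in> L2_eigenspace \<Omega> (neumann_domain \<alpha> \<Omega>) lam"
    by (rule L2_eigenspace_parity_part[OF problem_P_domain_C2 odd_part_neumann assms])
  moreover have "AE x in lebesgue_on \<Omega>. parity_part (- 1) u x + parity_part (- 1) u (- x) = 0"
    by (rule AE_lebesgue_onI) (simp add: parity_part_apply)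
  ultimately show ?thesis unfolding L2_second_series_def L2_eigenfunctions_def by blast
qed

theorem L2_eigenspace_problem_P:
  "L2_eigenspace \<Omega> (problem_P_domain k \<alpha> \<Omega>) lam
     = L2_span \<Omega> (L2_first_series \<alpha> \<Omega> lam \<union> L2_second_series \<alpha> \<Omega> lam)" (is "?E = L2_span \<Omega> ?S")
proof
  have "cspan ?S \<subseteq> ?E"
  proof (rule cspan_minimal)
    show "?S \<subseteq> ?E"
      using L2_first_series_subset L2_second_series_subset unfolding L2_eigenfunctions_def by blast
  qed (rule zero_in_L2_eigenspace, rule L2_eigenspace_lincomb)
  show "L2_span \<Omega> ?S \<subseteq> ?E"
  proof
    fix u assume "u \<in> L2_span \<Omega> ?S"
    then obtain s where s: "u \<in> L2_on \<Omega>" "s \<in> cspan ?S" "AE x in lebesgue_on \<Omega>. u x = s x"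
      unfolding L2_span_def by blast
    have "AE x in lebesgue_on \<Omega>. s x = u x" using s(3) by eventually_elim simp
    with s \<open>cspan ?S \<subseteq> ?E\<close> show "u \<in> ?E" by (blast intro: L2_eigenspace_cong_AE)
  qed
  show "?E \<subseteq> L2_span \<Omega> ?S"
  proof
    fix u assume u: "u \<in> ?E"
    have rep: "\<exists>t\<in>cspan ?S. AE x in lebesgue_on \<Omega>. p x = t x"
      if "(AE x in lebesgue_on \<Omega>. p x = 0) \<or> p \<in> ?S" for p
      using that
    proof
      assume "AE x in lebesgue_on \<Omega>. p x = 0"
      then show ?thesis by (intro bexI[of _ "\<lambda>_. 0"] cspan_zero)
    next
      assume "p \<in> ?S"
      then show ?thesis using cspan_superset[of ?S] by (intro bexI[of _ p]) auto
    qed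
    obtain v where v: "v \<in> cspan ?S" "AE x in lebesgue_on \<Omega>. parity_part 1 u x = v x"
      using rep[of "parity_part 1 u"] L2_even_part_series[OF u] by blast
    obtain w where w: "w \<in> cspan ?S" "AE x in lebesgue_on \<Omega>. parity_part (- 1) u x = w x"
      using rep[of "parity_part (- 1) u"] L2_odd_part_series[OF u] by blast
    have "AE x in lebesgue_on \<Omega>. u x = v x + w x"
      using v(2) w(2) by eventually_elim (metis even_part_plus_odd_part)
    then show "u \<in> L2_span \<Omega> ?S"
      unfolding L2_span_def mem_Collect_eq
      by (intro conjI L2_eigenspace_L2_on[OF u] bexI[OF _ cspan_add[OF v(1) w(1)]])
  qed
qed

theorem L2_eigenvalues_problem_P:
  "L2_eigenfunctions \<Omega> (problem_P_domain k \<alpha> \<Omega>) lam \<noteq> {} \<longleftrightarrow>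
     L2_first_series \<alpha> \<Omega> lam \<noteq> {} \<or> L2_second_series \<alpha> \<Omega> lam \<noteq> {}"
proof
  assume "L2_eigenfunctions \<Omega> (problem_P_domain k \<alpha> \<Omega>) lam \<noteq> {}"
  then obtain u where u: "u \<in> L2_eigenspace \<Omega> (problem_P_domain k \<alpha> \<Omega>) lam"
    and nz: "\<not> (AE x in lebesgue_on \<Omega>. u x = 0)"
    unfolding L2_eigenfunctions_def by blast
  have "AE x in lebesgue_on \<Omega>. u x = 0"
    if "AE x in lebesgue_on \<Omega>. parity_part 1 u x = 0" "AE x in lebesgue_on \<Omega>. parity_part (- 1) u x = 0"
    using that by eventually_elim (metis add_0 even_part_plus_odd_part)
  with nz show "L2_first_series \<alpha> \<Omega> lam \<noteq> {} \<or> L2_second_series \<alpha> \<Omega> lam \<noteq> {}"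
    using L2_even_part_series[OF u] L2_odd_part_series[OF u] by blast
next
  assume "L2_first_series \<alpha> \<Omega> lam \<noteq> {} \<or> L2_second_series \<alpha> \<Omega> lam \<noteq> {}"
  then show "L2_eigenfunctions \<Omega> (problem_P_domain k \<alpha> \<Omega>) lam \<noteq> {}"
    using L2_first_series_subset[of \<alpha> lam k] L2_second_series_subset[of \<alpha> lam k] by blast
qed

end

section \<open>Spectral decomposition of problem P\<close>

theorem theorem4p3:
  fixes \<Omega> :: "(real^'n::finite) set" and k :: 'n and \<alpha> :: real
  assumes "CARD('n) \<ge> 2"
    and "open \<Omega>" and "connected \<Omega>" and "\<Omega> \<noteq> {}" and "bounded \<Omega>"
    and "smooth_boundary \<Omega>"
    and "\<forall>x\<in>\<Omega>. - x \<in> \<Omega>"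
    and "0 < \<alpha>" and "\<alpha> < 1"
  shows
    "{lam. eigenfunctions \<Omega> (problem_P_domain k \<alpha> \<Omega>) lam \<noteq> {}} =
       {lam. first_series \<alpha> \<Omega> lam \<noteq> {}} \<union> {lam. second_series \<alpha> \<Omega> lam \<noteq> {}} \<and>
     (\<forall>lam. eigenspace \<Omega> (problem_P_domain k \<alpha> \<Omega>) lam =
       cspan (first_series \<alpha> \<Omega> lam \<union> second_series \<alpha> \<Omega> lam)) \<and>
     {lam. L2_eigenfunctions \<Omega> (problem_P_domain k \<alpha> \<Omega>) lam \<noteq> {}} =
       {lam. L2_first_series \<alpha> \<Omega> lam \<noteq> {}} \<union> {lam. L2_second_series \<alpha> \<Omega> lam \<noteq> {}} \<and>
     (\<forall>lam. L2_eigenspace \<Omega> (problem_P_domain k \<alpha> \<Omega>) lam =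
       L2_span \<Omega> (L2_first_series \<alpha> \<Omega> lam \<union> L2_second_series \<alpha> \<Omega> lam))"
proof -
  interpret symmetric_smooth_domain \<Omega>
    using assms by unfold_locales auto
  show ?thesis
  proof (intro conjI allI)
    show "{lam. eigenfunctions \<Omega> (problem_P_domain k \<alpha> \<Omega>) lam \<noteq> {}} =
        {lam. first_series \<alpha> \<Omega> lam \<noteq> {}} \<union> {lam. second_series \<alpha> \<Omega> lam \<noteq> {}}"
      unfolding classical_eigenvalues by (rule Collect_disj_eq)
    show "{lam. L2_eigenfunctions \<Omega> (problem_P_domain k \<alpha> \<Omega>) lam \<noteq> {}} =
        {lam. L2_first_series \<alpha> \<Omega> lam \<noteq> {}} \<union> {lam. L2_second_series \<alpha> \<Omega> lam \<noteq> {}}"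
      unfolding L2_eigenvalues_problem_P by (rule Collect_disj_eq)
  qed (rule classical_eigenspace, rule L2_eigenspace_problem_P)
qed

end
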